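(* Let $F=a_1x_1^2x_2+a_2x_2^2x_3+a_3x_3^2x_4+a_4x_4^2x_5+a_5x_5^2x_6+a_6x_6^2x_1+a_7x_1x_3x_5+a_8x_2x_4x_6$ with $a_i\in\mathbb{C}$. Then $F$ is $N_{\mathrm{SL}(6,\mathbb{C})}(G_1)$-semistable if and only if one of the following holds: (1) $a_7,a_8\neq0$; (2) $a_2,a_4,a_6,a_7\ne0$; (3) $a_1,a_3,a_5,a_8\neq0$; (4) $a_1,a_2,\dots,a_6\neq0$. It is $N_{\mathrm{SL}(6,\mathbb{C})}(G_1)$-stable if and only if $a_1,a_2,\dots,a_6\neq0$.
   Context: Let $C_7\subset\mathrm{SL}(6,\mathbb{C})$ be generated by $g_7=\mathrm{diag}(\zeta,\zeta^5,\zeta^4,\zeta^6,\zeta^2,\zeta^3)$, $\zeta=e^{2\pi i/7}$, let $\mu_6$ be the scalar matrices in $\mathrm{SL}(6,\mathbb{C})$, and $G_1=\mu_6C_7$. The space $\mathcal{V}_{C_7}$ of $C_7$-invariant cubic forms in $x_1,\dots,x_6$ is spanned by the eight monomials appearing in $F$. The normalizer $N_{\mathrm{SL}(6,\mathbb{C})}(G_1)$ is a reductive group (its identity component is the group of diagonal matrices of determinant $1$) acting linearly on $\mathcal{V}_{C_7}$ by linear change of variables; (semi)stability is in the sense of GIT for this action on $\mathbb{P}\mathcal{V}_{C_7}$. *)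

theory Defs
  imports
    "HOL-Analysis.Analysis"
    "HOL-Algebra.Generated_Groups"
    "HOL-Algebra.Group_Action"
begin

section \<open>Semistability and stability for a linear group action\<close>

text \<open>
  A group \<open>G\<close> acts linearly, through \<open>act\<close>, on a finite-dimensional complex vector space
  \<open>V\<close> of complex-valued functions; vector space operations are pointwise, and \<open>V\<close> is given
  by its carrier set.
\<close>

definition linear_functional_on :: "('a \<Rightarrow> complex) set \<Rightarrow> (('a \<Rightarrow> complex) \<Rightarrow> complex) \<Rightarrow> bool" where
  "linear_functional_on V l \<longleftrightarrow>
     (\<forall>v\<in>V. \<forall>w\<in>V. \<forall>a b. l (\<lambda>x. a * v x + b * w x) = a * l v + b * l w)"

text \<open>
  Homogeneous polynomial functions of degree \<open>d\<close> on \<open>V\<close>, that is, elements of the \<open>d\<close>-th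
  symmetric power of the dual of \<open>V\<close>: linear combinations of products of \<open>d\<close> linear
  functionals. Only the values of \<open>P\<close> on \<open>V\<close> are relevant.
\<close>

definition homogeneous_poly_on ::
    "('a \<Rightarrow> complex) set \<Rightarrow> nat \<Rightarrow> (('a \<Rightarrow> complex) \<Rightarrow> complex) \<Rightarrow> bool" where
  "homogeneous_poly_on V d P \<longleftrightarrow>
     (\<exists>(m::nat) c l. (\<forall>i<m. \<forall>j<d. linear_functional_on V (l i j)) \<and>
        (\<forall>v\<in>V. P v = (\<Sum>i<m. c i * (\<Prod>j<d. l i j v))))"

definition invariant_form ::
    "('g, 'm) monoid_scheme \<Rightarrow> ('g \<Rightarrow> ('a \<Rightarrow> complex) \<Rightarrow> ('a \<Rightarrow> complex)) \<Rightarrow>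
     ('a \<Rightarrow> complex) set \<Rightarrow> nat \<Rightarrow> (('a \<Rightarrow> complex) \<Rightarrow> complex) \<Rightarrow> bool" where
  "invariant_form G act V d P \<longleftrightarrow>
     homogeneous_poly_on V d P \<and> (\<forall>g\<in>carrier G. \<forall>v\<in>V. P (act g v) = P v)"

text \<open>
  The point \<open>[v]\<close> of the projective space of \<open>V\<close> is represented by the set of nonzero
  multiples of \<open>v\<close>.
\<close>

definition proj_point :: "('a \<Rightarrow> complex) \<Rightarrow> ('a \<Rightarrow> complex) set" where
  "proj_point v = {(\<lambda>x. c * v x) | c. c \<noteq> 0}"

definition zariski_closed :: "('a \<Rightarrow> complex) set \<Rightarrow> ('a \<Rightarrow> complex) set set \<Rightarrow> bool" where
  "zariski_closed V Z \<longleftrightarrow>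
     (\<exists>S. (\<forall>Q\<in>S. \<exists>d. homogeneous_poly_on V d Q) \<and>
          Z = {proj_point v | v. v \<in> V \<and> v \<noteq> (\<lambda>_. 0) \<and> (\<forall>Q\<in>S. Q v = 0)})"

definition nonvanishing_locus ::
    "('a \<Rightarrow> complex) set \<Rightarrow> (('a \<Rightarrow> complex) \<Rightarrow> complex) \<Rightarrow> ('a \<Rightarrow> complex) set set" where
  "nonvanishing_locus V P = {proj_point v | v. v \<in> V \<and> v \<noteq> (\<lambda>_. 0) \<and> P v \<noteq> 0}"

abbreviation proj_act ::
    "('g \<Rightarrow> ('a \<Rightarrow> complex) \<Rightarrow> ('a \<Rightarrow> complex)) \<Rightarrow>
     'g \<Rightarrow> ('a \<Rightarrow> complex) set \<Rightarrow> ('a \<Rightarrow> complex) set" where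
  "proj_act act \<equiv> \<lambda>g p. act g ` p"

text \<open>
  (Semi)stability of the point \<open>[v]\<close>, linearized by the action on \<open>V\<close>. Stability is proper
  stability in Mumford's terminology (finite stabilizers are required). The zero vector, which
  defines no point, is neither semistable nor stable.
\<close>

definition git_semistable ::
    "('g, 'm) monoid_scheme \<Rightarrow> ('g \<Rightarrow> ('a \<Rightarrow> complex) \<Rightarrow> ('a \<Rightarrow> complex)) \<Rightarrow>
     ('a \<Rightarrow> complex) set \<Rightarrow> ('a \<Rightarrow> complex) \<Rightarrow> bool" where
  "git_semistable G act V v \<longleftrightarrow>
     v \<in> V \<and> v \<noteq> (\<lambda>_. 0) \<and> (\<exists>d>0. \<exists>P. invariant_form G act V d P \<and> P v \<noteq> 0)"

definition git_stable ::
    "('g, 'm) monoid_scheme \<Rightarrow> ('g \<Rightarrow> ('a \<Rightarrow> complex) \<Rightarrow> ('a \<Rightarrow> complex)) \<Rightarrow>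
     ('a \<Rightarrow> complex) set \<Rightarrow> ('a \<Rightarrow> complex) \<Rightarrow> bool" where
  "git_stable G act V v \<longleftrightarrow>
     v \<in> V \<and> v \<noteq> (\<lambda>_. 0) \<and>
     finite (stabilizer G (proj_act act) (proj_point v)) \<and>
     (\<exists>d>0. \<exists>P. invariant_form G act V d P \<and> P v \<noteq> 0 \<and>
        (\<forall>p \<in> nonvanishing_locus V P. \<exists>Z. zariski_closed V Z \<and>
            orbit G (proj_act act) p = nonvanishing_locus V P \<inter> Z))"


section \<open>The groups\<close>

text \<open>
  In the index type \<open>6\<close> the numeral \<open>6\<close> equals \<open>0\<close>, so \<open>1, \<dots>, 6\<close> are its six distinct
  elements.
\<close>

definition SL6 :: "(complex^6^6) monoid" where
  "SL6 = \<lparr>carrier = {A. det A = 1}, mult = (**), one = mat 1\<rparr>"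

definition zeta7 :: complex where
  "zeta7 = exp (2 * of_real pi * \<i> / 7)"

definition g7 :: "complex^6^6" where
  "g7 = (\<chi> i j. if i = j
     then (vector [zeta7, zeta7^5, zeta7^4, zeta7^6, zeta7^2, zeta7^3] :: complex^6) $ i else 0)"

definition C7 :: "(complex^6^6) set" where
  "C7 = generate SL6 {g7}"

text \<open>\<open>mat c\<close> is the scalar matrix with diagonal entry \<open>c\<close>.\<close>

definition mu6 :: "(complex^6^6) set" where
  "mu6 = {A \<in> carrier SL6. \<exists>c. A = mat c}"

definition G1 :: "(complex^6^6) set" where
  "G1 = mu6 <#>\<^bsub>SL6\<^esub> C7"

definition N_G1 :: "(complex^6^6) monoid" where
  "N_G1 = SL6\<lparr>carrier := normalizer SL6 G1\<rparr>"


section \<open>Invariant cubic forms\<close>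

text \<open>Forms are identified with the polynomial functions they define, \<open>\<complex>\<close> being infinite.\<close>

definition cubic_forms :: "(complex^6 \<Rightarrow> complex) set" where
  "cubic_forms =
     {(\<lambda>x. \<Sum>i\<in>UNIV. \<Sum>j\<in>UNIV. \<Sum>k\<in>UNIV. c i j k * x$i * x$j * x$k) | c. True}"

definition change_vars :: "complex^6^6 \<Rightarrow> (complex^6 \<Rightarrow> complex) \<Rightarrow> (complex^6 \<Rightarrow> complex)" where
  "change_vars A F = (\<lambda>x. F (matrix_inv A *v x))"

definition V_C7 :: "(complex^6 \<Rightarrow> complex) set" where
  "V_C7 = {F \<in> cubic_forms. \<forall>A\<in>C7. change_vars A F = F}"

end

(*
  A matrix normalizing G1 permutes the eigenlines of g7. The exponents of g7 are the successive
  powers of 5 modulo 7, so N_G1 consists of the matrices of determinant 1 that are monomial along a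
  cyclic shift of the coordinates. Write O = a1 a3 a5 and E = a2 a4 a6. Semistability is witnessed
  by the invariants (a7 a8)^2, (O E)^2, E a7 + O a8 and (E a7)^2 + (O a8)^2; when none of the four
  conditions holds, some one-parameter subgroup has positive weights on all terms of F. If
  some a_i with i <= 6 vanishes, a nontrivial one-parameter subgroup has nonnegative weights on F:
  the limit has an infinite stabilizer, and would lie in the orbit of F if that orbit were closed.
  Conversely, where (O E)^2 does not vanish, a point is determined up to the full diagonal torus
  by a7 a8^2 / E, a7^2 a8 / O, a7^3 E / O^2 and a8^3 O / E^2, because the torus acts transitively on
  (a1, ..., a6) and the stabilizer of such a tuple multiplies a7 and a8 by a common, arbitrary cube
  root of unity. Odd shifts swap the roles of O, a7 and E, a8, so an N_G1-orbit is a union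
  of two such closed sets.
*)
theory Submission
  imports Defs
begin

section \<open>Monomial matrices along cyclic shifts\<close>

text \<open>Let D and D' be the products of the entries of a shift-monomial matrix over the odd and
  the even indices. Apart from the odd-even exchange, O is multiplied by D^2 D', E by D'^2 D, a7 by
  D and a8 by D'. Determinant 1 gives D D' = 1 or -1 according to the parity of the shift. Hence E
  a7 and O a8 scale by (D D')^2 = 1, whereas a7 a8 and O E can change sign and have to be squared.
  An odd shift exchanges E a7 and O a8, so only symmetric expressions in them are invariant; their
  sum can cancel, and the sum of squares then takes over. For orbits of projective points the
  determinant disappears: a scalar brings it to 1 without moving the point. This makes the full
  six-dimensional torus available, and with it the cyclic system d_i^2 d_{i+1} = e_i. Going once
  round the cycle raises d_i to the power (-2)^6 = 64, hence the 63rd roots of unity. Stability asks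
  for closedness of every orbit in the nonvanishing locus of the invariant, not just of the given
  one; explicit equations for all of them replace any argument about dimensions.\<close>

lemma exhaust_6:
  fixes x :: 6
  shows "x = 1 \<or> x = 2 \<or> x = 3 \<or> x = 4 \<or> x = 5 \<or> x = 6"
proof (induct x)
  case (of_int z)
  then have "z = 0 \<or> z = 1 \<or> z = 2 \<or> z = 3 \<or> z = 4 \<or> z = 5"
    by fastforce
  then show ?case
    by auto
qed

lemma UNIV_6: "UNIV = {1, 2, 3, 4, 5, 6::6}"
  using exhaust_6 by auto

lemma forall_6: "(\<forall>i::6. P i) \<longleftrightarrow> P 1 \<and> P 2 \<and> P 3 \<and> P 4 \<and> P 5 \<and> P 6"
  by (metis exhaust_6)

lemma sum_6: "sum f (UNIV::6 set) = f 1 + f 2 + f 3 + f 4 + f 5 + f 6"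
  unfolding UNIV_6 by (simp add: ac_simps)

lemma prod_6: "prod f (UNIV::6 set) = f 1 * f 2 * f 3 * f 4 * f 5 * f 6"
  unfolding UNIV_6 by (simp add: ac_simps)

lemma vector_6:
  "(vector [a, b, c, d, e, f] :: 'a::zero^6) $ 1 = a"
  "(vector [a, b, c, d, e, f] :: 'a::zero^6) $ 2 = b"
  "(vector [a, b, c, d, e, f] :: 'a::zero^6) $ 3 = c"
  "(vector [a, b, c, d, e, f] :: 'a::zero^6) $ 4 = d"
  "(vector [a, b, c, d, e, f] :: 'a::zero^6) $ 5 = e"
  "(vector [a, b, c, d, e, f] :: 'a::zero^6) $ 6 = f"
  unfolding vector_def by simp_all

lemma numeral_6_reduce:
  "(7::6) = 1" "(8::6) = 2" "(9::6) = 3" "(10::6) = 4" "(11::6) = 5" "(12::6) = 6" "(0::6) = 6"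
  by simp_all

section \<open>Exponents of \<open>g7\<close> modulo 7\<close>

definition wt :: "6 \<Rightarrow> nat" where
  "wt i = (vector [1, 5, 4, 6, 2, 3] :: nat^6) $ i"

lemma wt_simps [simp]: "wt 1 = 1" "wt 2 = 5" "wt 3 = 4" "wt 4 = 6" "wt 5 = 2" "wt 6 = 3"
  unfolding wt_def vector_6 by simp_all

text \<open>\<open>wt i\<close> is the power of 5 with exponent \<open>i - 1\<close>, reduced modulo
  7. Since 5 has order 6 modulo 7, addition in the cyclic type \<open>6\<close> becomes
  multiplication of weights.\<close>

lemma wt_add: "wt (i + s) mod 7 = wt (s + 1) * wt i mod 7"
proof -
  have "\<forall>s i. wt (i + s) mod 7 = wt (s + 1) * wt i mod 7"
    unfolding forall_6 by (simp add: numeral_6_reduce)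
  then show ?thesis by blast
qed

lemma wt_inj: "wt i mod 7 = wt j mod 7 \<Longrightarrow> i = j"
proof -
  have "\<forall>i j. wt i mod 7 = wt j mod 7 \<longrightarrow> i = j"
    unfolding forall_6 by simp
  then show "wt i mod 7 = wt j mod 7 \<Longrightarrow> i = j" by blast
qed

lemma wt_mod_neq_0: "wt i mod 7 \<noteq> 0"
proof -
  have "\<forall>i. wt i mod 7 \<noteq> 0" unfolding forall_6 by simp
  then show ?thesis by blast
qed

lemma wt_surj: "n mod 7 \<noteq> 0 \<Longrightarrow> \<exists>i. wt i mod 7 = n mod 7"
proof -
  assume "n mod 7 \<noteq> 0"
  then have "n mod 7 = 1 \<or> n mod 7 = 2 \<or> n mod 7 = 3 \<or> n mod 7 = 4 \<or> n mod 7 = 5 \<or> n mod 7 = 6"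
    by presburger
  moreover have "wt 1 mod 7 = 1" "wt 5 mod 7 = 2" "wt 6 mod 7 = 3" "wt 3 mod 7 = 4"
    "wt 2 mod 7 = 5" "wt 4 mod 7 = 6"
    by simp_all
  ultimately show ?thesis by metis
qed

lemma zeta7_power: "zeta7 ^ n = exp (2 * of_real pi * \<i> * of_nat n / of_nat 7)"
  unfolding zeta7_def by (simp add: exp_of_nat_mult [symmetric] mult_ac)

lemma zeta7_power_eq_iff: "zeta7 ^ m = zeta7 ^ n \<longleftrightarrow> m mod 7 = n mod 7"
  unfolding zeta7_power by (rule complex_root_unity_eq) simp

lemma if_zero_mult: "(if b then x else 0) * y = (if b then x * y else (0::complex))"
  by simp

text \<open>The addition \<open>i + s\<close> is that of the cyclic type \<open>6\<close>, so
  products add shifts and no permutation has to be carried along.\<close>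

definition cmat :: "6 \<Rightarrow> (6 \<Rightarrow> complex) \<Rightarrow> complex^6^6" where
  "cmat s d = (\<chi> i j. if j = i + s then d i else 0)"

lemma cmat_mult: "cmat s d ** cmat t e = cmat (s + t) (\<lambda>i. d i * e (i + s))"
  unfolding cmat_def matrix_matrix_mult_def vec_eq_iff
  by (simp add: if_zero_mult add.assoc cong: if_cong)

lemma cmat_vector: "(cmat s d *v x) $ i = d i * x $ (i + s)"
  unfolding cmat_def matrix_vector_mult_def
  by (simp add: if_zero_mult cong: if_cong)

lemma mat_eq_cmat: "mat c = cmat 0 (\<lambda>_. c)"
  unfolding cmat_def mat_def by (simp add: vec_eq_iff)

lemma cmat_eq_iff: "cmat s d = cmat s e \<longleftrightarrow> d = e"
  unfolding cmat_def vec_eq_iff by auto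

lemma det_cmat_0: "det (cmat 0 f) = prod f UNIV"
  unfolding cmat_def by (subst det_diagonal) auto

text \<open>Multiplying by the transpose leaves a diagonal matrix of squares, so the sign of the
  shift never has to be computed.\<close>

lemma det_cmat_square: "(det (cmat s d))\<^sup>2 = (prod d UNIV)\<^sup>2"
proof -
  have "cmat s d ** transpose (cmat s d) = cmat 0 (\<lambda>i. (d i)\<^sup>2)"
    unfolding cmat_def transpose_def matrix_matrix_mult_def vec_eq_iff
    by (auto simp: if_zero_mult power2_eq_square cong: if_cong)
  then have "det (cmat s d) * det (transpose (cmat s d)) = det (cmat 0 (\<lambda>i. (d i)\<^sup>2))"
    by (metis det_mul)
  then show ?thesis
    by (simp add: det_cmat_0 power2_eq_square prod.distrib)
qed

lemma det_cmat_eq_0_iff: "det (cmat s d) = 0 \<longleftrightarrow> (\<exists>i. d i = 0)"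
proof -
  have "det (cmat s d) = 0 \<longleftrightarrow> prod d UNIV = 0"
    using det_cmat_square[of s d] by (metis zero_eq_power2)
  then show ?thesis by simp
qed

lemma det_cmat_scale: "det (cmat s (\<lambda>i. c * d i)) = c ^ 6 * det (cmat s d)"
proof -
  have "cmat s (\<lambda>i. c * d i) = cmat 0 (\<lambda>_. c) ** cmat s d"
    by (simp add: cmat_mult)
  then show ?thesis
    by (simp add: det_mul det_cmat_0)
qed

lemma matrix_inv_eqI:
  fixes A B :: "'a::field^'n^'n"
  assumes "A ** B = mat 1"
  shows "matrix_inv A = B"
proof -
  have "B ** A = mat 1"
    using assms matrix_left_right_inverse by blast
  with assms have "\<exists>A'. A ** A' = mat 1 \<and> A' ** A = mat 1"
    by blast
  then have "A ** matrix_inv A = mat 1 \<and> matrix_inv A ** A = mat 1"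
    unfolding matrix_inv_def by (rule someI_ex)
  then have "matrix_inv A = (matrix_inv A ** A) ** B"
    using assms by (metis matrix_mul_assoc matrix_mul_rid)
  then show ?thesis
    using \<open>A ** matrix_inv A = mat 1 \<and> matrix_inv A ** A = mat 1\<close> by simp
qed

lemma SL6_simps [simp]:
  "carrier SL6 = {A. det A = 1}" "A \<otimes>\<^bsub>SL6\<^esub> B = A ** B" "\<one>\<^bsub>SL6\<^esub> = mat 1"
  by (simp_all add: SL6_def)

lemma matrix_inv_mult:
  fixes A :: "'a::field^'n^'n"
  assumes "det A \<noteq> 0"
  shows "A ** matrix_inv A = mat 1" "matrix_inv A ** A = mat 1"
proof -
  obtain B where "A ** B = mat 1"
    using assms invertible_det_nz invertible_def by blast
  then show "A ** matrix_inv A = mat 1"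
    using matrix_inv_eqI by blast
  then show "matrix_inv A ** A = mat 1"
    using matrix_left_right_inverse by blast
qed

lemma group_SL6: "group SL6"
proof (rule groupI)
  fix A assume "A \<in> carrier SL6"
  then have A: "det A = 1" by simp
  then have "matrix_inv A ** A = mat 1"
    by (simp add: matrix_inv_mult)
  then show "\<exists>B\<in>carrier SL6. B \<otimes>\<^bsub>SL6\<^esub> A = \<one>\<^bsub>SL6\<^esub>"
    using A by (metis (mono_tags, lifting) SL6_simps det_I det_mul mem_Collect_eq mult.right_neutral)
qed (auto simp: det_mul matrix_mul_assoc)

interpretation SL6: group SL6
  by (rule group_SL6)

lemma inv_SL6: "A \<in> carrier SL6 \<Longrightarrow> inv\<^bsub>SL6\<^esub> A = matrix_inv A"
  using SL6.r_inv[of A] matrix_inv_eqI[of A "inv\<^bsub>SL6\<^esub> A"] by auto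

section \<open>The normalizer\<close>

text \<open>This is \<open>c\<close> times the \<open>k\<close>-th power of \<open>g7\<close>; with
  \<open>c ^ 6 = 1\<close> it runs through \<open>G1\<close>.\<close>

definition wdiag :: "complex \<Rightarrow> nat \<Rightarrow> complex^6^6" where
  "wdiag c k = cmat 0 (\<lambda>i. c * zeta7 ^ (k * wt i))"

lemma g7_eq: "g7 = wdiag 1 1"
proof -
  have "\<forall>i. (vector [zeta7, zeta7^5, zeta7^4, zeta7^6, zeta7^2, zeta7^3] :: complex^6) $ i = zeta7 ^ wt i"
    unfolding forall_6 vector_6 by simp
  then show ?thesis
    unfolding g7_def wdiag_def cmat_def by (auto simp: vec_eq_iff)
qed

lemma zeta7_power_wt_cong: "k mod 7 = l mod 7 \<Longrightarrow> zeta7 ^ (k * wt i) = zeta7 ^ (l * wt i)"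
  unfolding zeta7_power_eq_iff by (metis mod_mult_left_eq)

lemma det_wdiag: "det (wdiag c k) = c ^ 6"
proof -
  have "(\<Prod>i\<in>UNIV. zeta7 ^ (k * wt i)) = zeta7 ^ (k * 21)"
    unfolding power_sum [symmetric] sum_6 by (simp add: mult.commute)
  also have "\<dots> = zeta7 ^ 0"
    unfolding zeta7_power_eq_iff by presburger
  finally show ?thesis
    by (simp add: wdiag_def det_cmat_0 prod.distrib)
qed

lemma wdiag_mult: "wdiag c k ** wdiag d l = wdiag (c * d) (k + l)"
proof -
  have "zeta7 ^ ((k + l) * wt i) = zeta7 ^ (k * wt i) * zeta7 ^ (l * wt i)" for i
    unfolding add_mult_distrib power_add ..
  then show ?thesis
    by (simp add: wdiag_def cmat_mult cmat_eq_iff mult_ac)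
qed

lemma wdiag_1_0: "wdiag 1 0 = mat 1"
  by (simp add: wdiag_def mat_eq_cmat)

lemma C7_eq: "C7 = range (wdiag 1)"
proof (rule equalityI; rule subsetI)
  fix A assume "A \<in> C7"
  then show "A \<in> range (wdiag 1)"
    unfolding C7_def
  proof (induction rule: generate.induct)
    case one
    have "wdiag 1 0 \<in> range (wdiag 1)" by (rule rangeI)
    then show ?case unfolding SL6_simps wdiag_1_0 .
  next
    case (incl h)
    then show ?case using g7_eq by simp
  next
    case (inv h)
    have "wdiag 1 1 ** wdiag 1 6 = wdiag 1 7"
      unfolding wdiag_mult by simp
    also have "\<dots> = mat 1"
      unfolding wdiag_1_0 [symmetric] wdiag_def cmat_eq_iff using zeta7_power_wt_cong [of 7 0] by auto
    finally have "matrix_inv (wdiag 1 1) = wdiag 1 6"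
      by (rule matrix_inv_eqI)
    moreover have "wdiag 1 1 \<in> carrier SL6"
      by (simp add: det_wdiag)
    ultimately have "inv\<^bsub>SL6\<^esub> g7 = wdiag 1 6"
      by (simp add: g7_eq inv_SL6)
    then show ?case
      using inv by simp
  next
    case (eng h1 h2)
    then obtain k l where "h1 = wdiag 1 k" "h2 = wdiag 1 l" by blast
    then have "h1 \<otimes>\<^bsub>SL6\<^esub> h2 = wdiag (1 * 1) (k + l)"
      by (simp only: SL6_simps wdiag_mult)
    then show ?case by (metis rangeI mult_1)
  qed
next
  fix A assume "A \<in> range (wdiag 1)"
  then obtain k where A: "A = wdiag 1 k" by blast
  have "wdiag 1 k \<in> generate SL6 {g7}"
  proof (induction k)
    case 0
    then show ?case using generate.one[of SL6] wdiag_1_0 by simp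
  next
    case (Suc k)
    have "g7 \<in> generate SL6 {g7}"
      by (simp add: generate.incl)
    from generate.eng[OF Suc this] show ?case
      unfolding SL6_simps g7_eq wdiag_mult by (simp only: mult_1 Suc_eq_plus1)
  qed
  then show "A \<in> C7"
    by (simp add: A C7_def)
qed

lemma mu6_eq: "mu6 = {mat c | c. c ^ 6 = 1}"
  unfolding mu6_def mat_eq_cmat by (auto simp: det_cmat_0)

lemma G1_eq: "G1 = {wdiag c k | c k. c ^ 6 = 1}"
proof -
  have *: "mat c \<otimes>\<^bsub>SL6\<^esub> wdiag 1 k = wdiag c k" for c k
    by (simp add: wdiag_def mat_eq_cmat cmat_mult)
  have "G1 = (\<Union>x\<in>{mat c | c. c ^ 6 = 1}. \<Union>k. {x \<otimes>\<^bsub>SL6\<^esub> wdiag 1 k})"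
    unfolding G1_def set_mult_def C7_eq mu6_eq by auto
  also have "\<dots> = {mat c \<otimes>\<^bsub>SL6\<^esub> wdiag 1 k | c k. c ^ 6 = 1}"
    by auto
  finally show ?thesis
    unfolding * .
qed

lemma G1_subset: "G1 \<subseteq> carrier SL6"
  unfolding G1_eq by (auto simp: det_wdiag)

text \<open>The exponents \<open>1, 5, 4, 6, 2, 3\<close> of \<open>g7\<close> are the successive powers of 5 modulo 7, so a
  cyclic shift of the coordinates raises \<open>g7\<close> to a power.\<close>

lemma wdiag_shift: "\<exists>l. cmat 0 (\<lambda>i. c * zeta7 ^ (k * wt (i + s))) = wdiag c l"
proof
  have "zeta7 ^ (k * wt (i + s)) = zeta7 ^ (k * wt (s + 1) * wt i)" for i
    unfolding zeta7_power_eq_iff using wt_add[of i s] by (metis mod_mult_right_eq mult.assoc)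
  then show "cmat 0 (\<lambda>i. c * zeta7 ^ (k * wt (i + s))) = wdiag c (k * wt (s + 1))"
    by (simp add: wdiag_def)
qed

lemma conj_cmat:
  assumes "det (cmat s d) \<noteq> 0"
  shows "cmat s d ** cmat 0 f ** matrix_inv (cmat s d) = cmat 0 (\<lambda>i. f (i + s))"
proof -
  have "cmat s d ** cmat 0 f = cmat 0 (\<lambda>i. f (i + s)) ** cmat s d"
    by (simp add: cmat_mult cmat_eq_iff mult.commute)
  then show ?thesis
    by (metis assms matrix_inv_mult(1) matrix_mul_assoc matrix_mul_rid)
qed

lemma conj_G1:
  "A \<in> carrier SL6 \<Longrightarrow>
    A <#\<^bsub>SL6\<^esub> G1 #>\<^bsub>SL6\<^esub> inv\<^bsub>SL6\<^esub> A = (\<lambda>B. A ** B ** matrix_inv A) ` G1"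
  unfolding l_coset_def r_coset_def inv_SL6 by auto

lemma carrier_N_G1_iff:
  "A \<in> carrier N_G1 \<longleftrightarrow> det A = 1 \<and> (\<lambda>B. A ** B ** matrix_inv A) ` G1 = G1"
  using G1_subset conj_G1[of A]
  by (auto simp: N_G1_def normalizer_def stabilizer_def)

lemma cmat_in_N_G1:
  assumes "det (cmat s d) = 1"
  shows "cmat s d \<in> carrier N_G1"
proof -
  have conj: "cmat s d ** wdiag c k ** matrix_inv (cmat s d) = cmat 0 (\<lambda>i. c * zeta7 ^ (k * wt (i + s)))" for c k
    using assms by (simp add: wdiag_def conj_cmat)
  have "(\<lambda>B. cmat s d ** B ** matrix_inv (cmat s d)) ` G1 = G1"
  proof (intro equalityI subsetI)
    fix A assume "A \<in> (\<lambda>B. cmat s d ** B ** matrix_inv (cmat s d)) ` G1"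
    then obtain c k where c: "c ^ 6 = 1" "A = cmat 0 (\<lambda>i. c * zeta7 ^ (k * wt (i + s)))"
      unfolding G1_eq using conj by auto
    then show "A \<in> G1"
      unfolding G1_eq mem_Collect_eq using wdiag_shift[of c k s] by metis
  next
    fix A assume "A \<in> G1"
    then obtain c k where c: "c ^ 6 = 1" "A = wdiag c k"
      unfolding G1_eq by auto
    \<comment> \<open>For surjectivity of the conjugation, the preimage is found by shifting back by
      \<open>s\<close>.\<close>
    obtain l where "cmat 0 (\<lambda>i. c * zeta7 ^ (k * wt (i + - s))) = wdiag c l"
      using wdiag_shift by blast
    then have l: "(\<lambda>i. c * zeta7 ^ (k * wt (i + - s))) = (\<lambda>i. c * zeta7 ^ (l * wt i))"
      unfolding wdiag_def cmat_eq_iff .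
    have "cmat 0 (\<lambda>i. c * zeta7 ^ (l * wt (i + s))) = A"
      unfolding c wdiag_def cmat_eq_iff
    proof
      fix i
      show "c * zeta7 ^ (l * wt (i + s)) = c * zeta7 ^ (k * wt i)"
        using fun_cong[OF l, of "i + s"] by auto
    qed
    then have "A = cmat s d ** wdiag c l ** matrix_inv (cmat s d)"
      using conj by simp
    moreover have "wdiag c l \<in> G1"
      unfolding G1_eq using c by blast
    ultimately show "A \<in> (\<lambda>B. cmat s d ** B ** matrix_inv (cmat s d)) ` G1"
      by blast
  qed
  then show ?thesis
    using assms by (simp add: carrier_N_G1_iff)
qed

text \<open>Comparing entries in \<open>A ** g7 = wdiag c k ** A\<close> ties the column of a
  nonzero entry to its row. Multiplying weights by \<open>k\<close> is a translation of indices, so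
  the resulting permutation is a shift.\<close>

lemma N_G1_imp_cmat:
  assumes "A \<in> carrier N_G1"
  shows "\<exists>s d. A = cmat s d"
proof -
  have det: "det A = 1" and conj: "(\<lambda>B. A ** B ** matrix_inv A) ` G1 = G1"
    using assms carrier_N_G1_iff by auto
  have "g7 \<in> G1"
    unfolding G1_eq g7_eq mem_Collect_eq by (metis power_one)
  then obtain c k where c: "c ^ 6 = 1" and "A ** g7 ** matrix_inv A = wdiag c k"
    using conj unfolding G1_eq by blast
  then have "A ** g7 = wdiag c k ** A"
    using det by (metis matrix_inv_mult(2) matrix_mul_assoc matrix_mul_rid zero_neq_one)
  moreover have "(A ** g7) $ i $ j = A $ i $ j * zeta7 ^ wt j" for i j
    unfolding g7_eq wdiag_def cmat_def matrix_matrix_mult_def by (simp add: if_distrib cong: if_cong)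
  moreover have "(wdiag c k ** A) $ i $ j = c * zeta7 ^ (k * wt i) * A $ i $ j" for i j
    unfolding wdiag_def cmat_def matrix_matrix_mult_def by (simp add: if_zero_mult cong: if_cong)
  ultimately have eq: "zeta7 ^ wt j = c * zeta7 ^ (k * wt i)" if "A $ i $ j \<noteq> 0" for i j
    using that by (metis mult.commute mult_cancel_left)
  have row: "\<exists>j. A $ i $ j \<noteq> 0" for i
  proof (rule ccontr)
    assume "\<nexists>j. A $ i $ j \<noteq> 0"
    then have "row i A = 0" by (simp add: row_def vec_eq_iff)
    then show False using det det_zero_row(1) by fastforce
  qed
  \<comment> \<open>\<open>c\<close> is a sixth root of unity, and also a seventh one because the
    other factors are powers of \<open>zeta7\<close>.\<close>
  have "c = 1"
  proof -
    obtain j where "zeta7 ^ wt j = c * zeta7 ^ (k * wt 1)"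
      using row eq by blast
    then have "c ^ 7 * (zeta7 ^ (k * wt 1)) ^ 7 = (zeta7 ^ wt j) ^ 7"
      by (simp add: power_mult_distrib)
    moreover have "(zeta7 ^ n) ^ 7 = 1" for n
      using zeta7_power_eq_iff[of "n * 7" 0] by (simp add: power_mult)
    ultimately have "c ^ 7 = 1" by simp
    moreover have "c ^ 7 = c ^ 6 * c"
      by (simp add: power_numeral_reduce)
    ultimately show ?thesis using c by simp
  qed
  then have weights: "wt j mod 7 = k * wt i mod 7" if "A $ i $ j \<noteq> 0" for i j
    using eq[OF that] by (simp add: zeta7_power_eq_iff)
  \<comment> \<open>No weight is 0 modulo 7, hence neither is \<open>k\<close>, which is therefore
    the weight of some \<open>j\<close>. The shift is \<open>j - 1\<close> because index 1 has
    weight 1.\<close>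
  obtain j where "A $ 6 $ j \<noteq> 0" using row by blast
  then have "k mod 7 \<noteq> 0"
    using weights wt_mod_neq_0 by (metis mod_0 mod_mult_left_eq mult_0)
  then obtain j where j: "wt j mod 7 = k mod 7"
    using wt_surj by blast
  have shift: "j' = i + (j - 1)" if "A $ i $ j' \<noteq> 0" for i j'
  proof (rule wt_inj)
    have "wt (i + (j - 1)) mod 7 = wt j * wt i mod 7"
      using wt_add[of i "j - 1"] by simp
    also have "\<dots> = k * wt i mod 7"
      using j by (metis mod_mult_left_eq)
    finally show "wt j' mod 7 = wt (i + (j - 1)) mod 7"
      using weights[OF that] by simp
  qed
  then have "A = cmat (j - 1) (\<lambda>i. A $ i $ (i + (j - 1)))"
    unfolding cmat_def vec_eq_iff by auto
  then show ?thesis by blast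
qed

lemma subgroup_N_G1: "subgroup (carrier N_G1) SL6"
  using SL6.normalizer_imp_subgroup[OF G1_subset] by (simp add: N_G1_def)

lemma N_G1_det: "A \<in> carrier N_G1 \<Longrightarrow> det A = 1"
  by (simp add: carrier_N_G1_iff)

lemma matrix_inv_N_G1: "A \<in> carrier N_G1 \<Longrightarrow> matrix_inv A \<in> carrier N_G1"
  using subgroup.m_inv_closed[OF subgroup_N_G1] inv_SL6 N_G1_det by fastforce

lemma mult_N_G1: "A \<in> carrier N_G1 \<Longrightarrow> B \<in> carrier N_G1 \<Longrightarrow> A ** B \<in> carrier N_G1"
  using subgroup.m_closed[OF subgroup_N_G1] by fastforce

lemma matrix_inv_matrix_inv:
  fixes A :: "'a::field^'n^'n"
  shows "det A \<noteq> 0 \<Longrightarrow> matrix_inv (matrix_inv A) = A"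
  by (simp add: matrix_inv_eqI matrix_inv_mult(2))

text \<open>Since scalar matrices act trivially on projective points, determinants do not matter for the
  orbits.\<close>

lemma scale_cmat_in_N_G1:
  assumes "\<And>i. d i \<noteq> 0"
  obtains c where "c \<noteq> 0" "cmat s (\<lambda>i. c * d i) \<in> carrier N_G1"
proof -
  have nz: "det (cmat s d) \<noteq> 0"
    using assms by (simp add: det_cmat_eq_0_iff)
  obtain c where c: "c ^ 6 = 1 / det (cmat s d)"
    using exists_complex_root by (metis zero_neq_numeral)
  have "c \<noteq> 0" using c nz by auto
  moreover have "cmat s (\<lambda>i. c * d i) \<in> carrier N_G1"
    by (rule cmat_in_N_G1) (simp add: det_cmat_scale c nz)
  ultimately show thesis using that by blast
qed

section \<open>Invariant cubic forms\<close>

text \<open>The coefficients \<open>a7\<close> and \<open>a8\<close> are named \<open>p\<close> and \<open>q\<close>.\<close>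

definition form :: "(6 \<Rightarrow> complex) \<Rightarrow> complex \<Rightarrow> complex \<Rightarrow> complex^6 \<Rightarrow> complex" where
  "form a p q = (\<lambda>x. (\<Sum>i\<in>UNIV. a i * (x$i)\<^sup>2 * x$(i + 1))
     + p * x$1 * x$3 * x$5 + q * x$2 * x$4 * x$6)"

definition oprod :: "(6 \<Rightarrow> complex) \<Rightarrow> complex" where
  "oprod a = a 1 * a 3 * a 5"

definition eprod :: "(6 \<Rightarrow> complex) \<Rightarrow> complex" where
  "eprod a = a 2 * a 4 * a 6"

lemma prod_UNIV_6_eq: "prod a (UNIV::6 set) = oprod a * eprod a"
  by (simp add: oprod_def eprod_def prod_6 mult_ac)

lemma oprod_eprod_neq_0: "oprod a \<noteq> 0 \<and> eprod a \<noteq> 0 \<longleftrightarrow> (\<forall>i. a i \<noteq> 0)"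
  unfolding forall_6 oprod_def eprod_def by auto

text \<open>Precomposition without the inverse in \<open>change_vars\<close>. As \<open>N_G1\<close>
  is closed under inverses, both lead to the same orbits and invariants.\<close>

definition pull :: "complex^6^6 \<Rightarrow> (complex^6 \<Rightarrow> complex) \<Rightarrow> complex^6 \<Rightarrow> complex" where
  "pull B F = (\<lambda>x. F (B *v x))"

lemma change_vars_eq_pull: "change_vars A F = pull (matrix_inv A) F"
  by (simp add: change_vars_def pull_def)

lemma pull_pull: "pull A (pull B F) = pull (B ** A) F"
  by (simp add: pull_def matrix_vector_mul_assoc)

lemma pull_mat_1 [simp]: "pull (mat 1) F = F"
  by (simp add: pull_def)

abbreviation evens :: "6 set" where "evens \<equiv> {2, 4, 6}"
abbreviation odds :: "6 set" where "odds \<equiv> {1, 3, 5}"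

lemma evens_or_odds: "s \<in> evens \<or> s \<in> odds"
  using exhaust_6[of s] by auto

lemma minus_in_evens: "s \<in> evens \<Longrightarrow> - s \<in> evens"
  and minus_in_odds: "s \<in> odds \<Longrightarrow> - s \<in> odds"
  by (auto simp: minus_equation_iff neg_eq_iff_add_eq_0)

lemma oprod_shift:
  "s \<in> evens \<Longrightarrow> oprod (\<lambda>i. f (i + s)) = oprod f"
  "s \<in> evens \<Longrightarrow> eprod (\<lambda>i. f (i + s)) = eprod f"
  "s \<in> odds \<Longrightarrow> oprod (\<lambda>i. f (i + s)) = eprod f"
  "s \<in> odds \<Longrightarrow> eprod (\<lambda>i. f (i + s)) = oprod f"
  by (auto simp: oprod_def eprod_def numeral_6_reduce mult_ac)

text \<open>In the product of \<open>(d i)\<^sup>2 * d (i + 1)\<close> over odd \<open>i\<close>,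
  the odd entries of \<open>d\<close> occur squared and the even ones once; for even
  \<open>i\<close> it is the reverse. An odd shift then exchanges the two parity classes.\<close>

lemma pull_form:
  obtains a' p' q' where
    "pull (cmat s d) (form a p q) = form a' p' q'"
    "\<And>i. a' (i + s) = a i * (d i)\<^sup>2 * d (i + 1)"
    "(s \<in> evens \<and> p' = p * oprod d \<and> q' = q * eprod d \<and>
       oprod a' = oprod a * (oprod d)\<^sup>2 * eprod d \<and> eprod a' = eprod a * (eprod d)\<^sup>2 * oprod d) \<or>
     (s \<in> odds \<and> p' = q * eprod d \<and> q' = p * oprod d \<and>
       oprod a' = eprod a * (eprod d)\<^sup>2 * oprod d \<and> eprod a' = oprod a * (oprod d)\<^sup>2 * eprod d)"
proof -
  define g where "g = (\<lambda>i. a i * (d i)\<^sup>2 * d (i + 1))"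
  define a' where "a' = (\<lambda>i. g (i + - s))"
  have g: "oprod g = oprod a * (oprod d)\<^sup>2 * eprod d" "eprod g = eprod a * (eprod d)\<^sup>2 * oprod d"
    by (simp_all add: g_def oprod_def eprod_def numeral_6_reduce power_mult_distrib mult_ac)
  have sum: "(\<Sum>i\<in>UNIV. a i * ((cmat s d *v x)$i)\<^sup>2 * (cmat s d *v x)$(i + 1)) =
      (\<Sum>i\<in>UNIV. a' i * (x$i)\<^sup>2 * x$(i + 1))" for x
    by (rule sum.reindex_bij_witness[of _ "\<lambda>i. i - s" "\<lambda>i. i + s"])
      (simp_all add: cmat_vector a'_def g_def power_mult_distrib algebra_simps)
  have a': "a' (i + s) = a i * (d i)\<^sup>2 * d (i + 1)" for i
    by (simp add: a'_def g_def)
  show thesis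
  proof (cases "s \<in> evens")
    case True
    have "p * (cmat s d *v x)$1 * (cmat s d *v x)$3 * (cmat s d *v x)$5 +
        q * (cmat s d *v x)$2 * (cmat s d *v x)$4 * (cmat s d *v x)$6 =
        p * oprod d * x$1 * x$3 * x$5 + q * eprod d * x$2 * x$4 * x$6" for x
      using True by (auto simp: cmat_vector oprod_def eprod_def numeral_6_reduce mult_ac)
    then have "pull (cmat s d) (form a p q) = form a' (p * oprod d) (q * eprod d)"
      unfolding pull_def form_def fun_eq_iff by (simp only: sum add.assoc simp_thms)
    moreover have "oprod a' = oprod g" "eprod a' = eprod g"
      unfolding a'_def using oprod_shift minus_in_evens[OF True] by blast+
    ultimately show thesis
      using that[of a' "p * oprod d" "q * eprod d"] True a' g by metis
  next
    case False
    then have s: "s \<in> odds" using evens_or_odds by blast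
    have "p * (cmat s d *v x)$1 * (cmat s d *v x)$3 * (cmat s d *v x)$5 +
        q * (cmat s d *v x)$2 * (cmat s d *v x)$4 * (cmat s d *v x)$6 =
        q * eprod d * x$1 * x$3 * x$5 + p * oprod d * x$2 * x$4 * x$6" for x
      using s by (auto simp: cmat_vector oprod_def eprod_def numeral_6_reduce mult_ac)
    then have "pull (cmat s d) (form a p q) = form a' (q * eprod d) (p * oprod d)"
      unfolding pull_def form_def fun_eq_iff by (simp only: sum add.assoc simp_thms)
    moreover have "oprod a' = eprod g" "eprod a' = oprod g"
      unfolding a'_def using oprod_shift minus_in_odds[OF s] by blast+
    ultimately show thesis
      using that[of a' "q * eprod d" "p * oprod d"] s a' g by metis
  qed
qed

text \<open>Points at which a single monomial of \<open>form a p q\<close> survives: evaluation there reads off the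
  coefficients, which makes these linear functionals.\<close>

definition pt :: "6 \<Rightarrow> complex^6" where
  "pt i = (\<chi> j. if j = i \<or> j = i + 1 then 1 else 0)"

definition pt_odd :: "complex^6" where
  "pt_odd = (\<chi> j. if j \<in> odds then 1 else 0)"

definition pt_even :: "complex^6" where
  "pt_even = (\<chi> j. if j \<in> evens then 1 else 0)"

lemma form_pt [simp]: "form a p q (pt i) = a i" "form a p q pt_odd = p" "form a p q pt_even = q"
proof -
  have "\<forall>i. form a p q (pt i) = a i"
    unfolding forall_6 form_def pt_def sum_6 by (simp add: numeral_6_reduce)
  then show "form a p q (pt i) = a i" by blast
qed (simp_all add: form_def pt_odd_def pt_even_def sum_6 numeral_6_reduce)

lemma form_eq_iff: "form a p q = form b p' q' \<longleftrightarrow> a = b \<and> p = p' \<and> q = q'"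
proof
  assume "form a p q = form b p' q'"
  then have "a i = b i" "p = p'" "q = q'" for i
    using form_pt by metis+
  then show "a = b \<and> p = p' \<and> q = q'" by auto
qed simp

lemma form_0: "form (\<lambda>_. 0) 0 0 = (\<lambda>_. 0)"
  by (simp add: form_def)

lemma form_lincomb:
  "(\<lambda>x. c * form a p q x + e * form b p' q' x) =
     form (\<lambda>i. c * a i + e * b i) (c * p + e * p') (c * q + e * q')"
  by (simp add: form_def fun_eq_iff sum_distrib_left distrib_left distrib_right sum.distrib mult_ac)

lemma form_scale: "(\<lambda>x. c * form a p q x) = form (\<lambda>i. c * a i) (c * p) (c * q)"
  using form_lincomb[of c a p q 0] by simp

lemma form_cubic: "form a p q \<in> cubic_forms"
proof -
  define c :: "6 \<Rightarrow> 6 \<Rightarrow> 6 \<Rightarrow> complex" where "c = (\<lambda>i j k.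
     (if j = i then if k = i + 1 then a i else 0 else 0) +
     (if i = 1 then if j = 3 then if k = 5 then p else 0 else 0 else 0) +
     (if i = 2 then if j = 4 then if k = 6 then q else 0 else 0 else 0))"
  have "form a p q = (\<lambda>x. \<Sum>i\<in>UNIV. \<Sum>j\<in>UNIV. \<Sum>k\<in>UNIV. c i j k * x$i * x$j * x$k)"
    unfolding c_def form_def sum_6 fun_eq_iff
    by (simp add: numeral_6_reduce power2_eq_square mult_ac)
  then show ?thesis
    unfolding cubic_forms_def by blast
qed

text \<open>Modulo 7, \<open>wt (i + 1)\<close> is 5 times \<open>wt i\<close>, so
  \<open>2 * wt i + wt (i + 1)\<close> is a multiple of 7. The two squarefree monomials have weights
  1 + 4 + 2 = 7 and 5 + 6 + 3 = 14.\<close>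

lemma pull_wdiag_form: "pull (wdiag 1 k) (form a p q) = form a p q"
proof -
  define d where "d = (\<lambda>i. zeta7 ^ (k * wt i))"
  have one: "zeta7 ^ (7 * n) = 1" for n
    using zeta7_power_eq_iff[of "7 * n" 0] by simp
  have dvd: "\<forall>i. 7 dvd (2 * wt i + wt (i + 1))"
    unfolding forall_6 by (simp add: numeral_6_reduce)
  then have d: "(d i)\<^sup>2 * d (i + 1) = 1" for i
  proof -
    obtain m where m: "2 * wt i + wt (i + 1) = 7 * m"
      using dvd by blast
    have "(d i)\<^sup>2 * d (i + 1) = zeta7 ^ (k * (2 * wt i + wt (i + 1)))"
      by (simp add: d_def power_add distrib_left power_mult [symmetric] mult_ac)
    then show ?thesis
      unfolding m using one[of "k * m"] by (simp add: mult_ac)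
  qed
  have "d 1 * d 3 * d 5 = zeta7 ^ (7 * k)" "d 2 * d 4 * d 6 = zeta7 ^ (7 * (2 * k))"
    by (simp_all add: d_def power_add [symmetric])
  then have d': "d 1 * d 3 * d 5 = 1" "d 2 * d 4 * d 6 = 1"
    unfolding one .
  have 1: "a i * (d i * x$i)\<^sup>2 * (d (i + 1) * x$(i + 1)) = a i * (x$i)\<^sup>2 * x$(i + 1)" for i and x :: "complex^6"
    using d[of i] by (simp add: power_mult_distrib mult_ac)
  have 2: "p * (d 1 * x$1) * (d 3 * x$3) * (d 5 * x$5) = p * x$1 * x$3 * x$5" for x :: "complex^6"
  proof -
    have "p * (d 1 * x$1) * (d 3 * x$3) * (d 5 * x$5) = (d 1 * d 3 * d 5) * (p * x$1 * x$3 * x$5)"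
      by (simp only: mult_ac)
    then show ?thesis unfolding d' by simp
  qed
  have 3: "q * (d 2 * x$2) * (d 4 * x$4) * (d 6 * x$6) = q * x$2 * x$4 * x$6" for x :: "complex^6"
  proof -
    have "q * (d 2 * x$2) * (d 4 * x$4) * (d 6 * x$6) = (d 2 * d 4 * d 6) * (q * x$2 * x$4 * x$6)"
      by (simp only: mult_ac)
    then show ?thesis unfolding d' by simp
  qed
  have "(wdiag 1 k *v x) $ i = d i * x $ i" for i x
    by (simp add: wdiag_def cmat_vector d_def)
  then show ?thesis
    unfolding pull_def form_def by (simp only: 1 2 3)
qed

lemma matrix_inv_wdiag: "matrix_inv (wdiag 1 k) = wdiag 1 (6 * k)"
proof (rule matrix_inv_eqI)
  have "wdiag 1 k ** wdiag 1 (6 * k) = wdiag 1 (7 * k)"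
    by (simp add: wdiag_mult)
  also have "\<dots> = wdiag 1 0"
    unfolding wdiag_def cmat_eq_iff using zeta7_power_wt_cong[of "7 * k" 0] by simp
  finally show "wdiag 1 k ** wdiag 1 (6 * k) = mat 1"
    by (simp add: wdiag_1_0)
qed

lemma sum_zeta7_powers: "(\<Sum>l<7. zeta7 ^ (l * n)) = (if n mod 7 = 0 then 7 else 0)"
proof (cases "n mod 7 = 0")
  case True
  then have "zeta7 ^ (l * n) = 1" for l
    using zeta7_power_eq_iff[of "l * n" 0] by auto
  then show ?thesis using True by simp
next
  case False
  then have "zeta7 ^ n \<noteq> 1"
    using zeta7_power_eq_iff[of n 0] by auto
  moreover have "(zeta7 ^ n) ^ 7 = 1"
    using zeta7_power_eq_iff[of "n * 7" 0] by (simp add: power_mult)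
  ultimately have "(\<Sum>l<7. (zeta7 ^ n) ^ l) = 0"
    by (simp add: sum_gp_strict)
  then show ?thesis
    using False by (simp add: power_mult [symmetric] mult.commute)
qed

text \<open>Averaging over \<open>C7\<close> kills the monomials that are not invariant.\<close>

lemma V_C7_imp_form:
  assumes "F \<in> V_C7"
  shows "\<exists>a p q. F = form a p q"
proof -
  obtain c where F: "F = (\<lambda>x. \<Sum>i\<in>UNIV. \<Sum>j\<in>UNIV. \<Sum>k\<in>UNIV. c i j k * x$i * x$j * x$k)"
    using assms by (auto simp: V_C7_def cubic_forms_def)
  define e where "e = (\<lambda>i j k. if (wt i + wt j + wt k) mod 7 = 0 then c i j k else 0)"
  have inv: "F (wdiag 1 l *v x) = F x" for l x
  proof -
    have "change_vars (wdiag 1 l) F = F"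
      using assms by (auto simp: V_C7_def C7_eq)
    then have "pull (wdiag 1 l) F = pull (wdiag 1 l) (pull (wdiag 1 (6 * l)) F)"
      by (simp add: change_vars_eq_pull matrix_inv_wdiag)
    also have "\<dots> = pull (mat 1) F"
      unfolding pull_pull using matrix_inv_wdiag[of l] matrix_inv_mult(2)[of "wdiag 1 l"]
      by (simp add: det_wdiag)
    finally show ?thesis by (simp add: pull_def fun_eq_iff)
  qed
  have F': "F x = (\<Sum>i\<in>UNIV. \<Sum>j\<in>UNIV. \<Sum>k\<in>UNIV. e i j k * x$i * x$j * x$k)" for x
  proof -
    have "7 * F x = (\<Sum>l<7. F (wdiag 1 l *v x))"
      by (simp add: inv)
    also have "\<dots> = (\<Sum>l<7. \<Sum>i\<in>UNIV. \<Sum>j\<in>UNIV. \<Sum>k\<in>UNIV.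
        c i j k * x$i * x$j * x$k * zeta7 ^ (l * (wt i + wt j + wt k)))"
      unfolding F wdiag_def cmat_vector by (simp add: distrib_left power_add mult_ac)
    also have "\<dots> = (\<Sum>i\<in>UNIV. \<Sum>j\<in>UNIV. \<Sum>k\<in>UNIV. \<Sum>l<7.
        c i j k * x$i * x$j * x$k * zeta7 ^ (l * (wt i + wt j + wt k)))"
      by (subst sum.swap, intro sum.cong refl)+
    also have "\<dots> = (\<Sum>i\<in>UNIV. \<Sum>j\<in>UNIV. \<Sum>k\<in>UNIV. 7 * (e i j k * x$i * x$j * x$k))"
      by (intro sum.cong refl) (simp add: sum_distrib_left [symmetric] sum_zeta7_powers e_def)
    finally show ?thesis
      by (simp add: sum_distrib_left [symmetric])
  qed
  \<comment> \<open>Only the eight monomials have weight divisible by 7; each collects the three or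
    six orderings of its index triple.\<close>
  have "F = form (\<lambda>i. e i i (i + 1) + e i (i + 1) i + e (i + 1) i i)
     (e 1 3 5 + e 1 5 3 + e 3 1 5 + e 3 5 1 + e 5 1 3 + e 5 3 1)
     (e 2 4 6 + e 2 6 4 + e 4 2 6 + e 4 6 2 + e 6 2 4 + e 6 4 2)"
    unfolding fun_eq_iff F' form_def sum_6
    by (simp add: e_def numeral_6_reduce power2_eq_square algebra_simps)
  then show ?thesis by blast
qed

lemma V_C7_eq: "V_C7 = {form a p q | a p q. True}"
proof -
  have "form a p q \<in> V_C7" for a p q
    unfolding V_C7_def C7_eq
    by (auto simp: form_cubic change_vars_eq_pull matrix_inv_wdiag pull_wdiag_form)
  then show ?thesis using V_C7_imp_form by blast
qed

lemma form_in_V [simp]: "form a p q \<in> V_C7"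
  by (auto simp: V_C7_eq)

section \<open>Homogeneous polynomials and projective points\<close>

lemma homogeneous_poly_on_cong:
  assumes "homogeneous_poly_on V d P" "\<And>v. v \<in> V \<Longrightarrow> Q v = P v"
  shows "homogeneous_poly_on V d Q"
proof -
  obtain m c l where "\<forall>i<(m::nat). \<forall>j<d. linear_functional_on V (l i j)"
    "\<forall>v\<in>V. P v = (\<Sum>i<m. c i * (\<Prod>j<d. l i j v))"
    using assms(1) unfolding homogeneous_poly_on_def by blast
  then show ?thesis
    unfolding homogeneous_poly_on_def using assms(2)
    by (intro exI[of _ m] exI[of _ c] exI[of _ l]) simp
qed

lemma sum_lessThan_add: "sum f {..<m + n} = sum f {..<m} + (\<Sum>i<n. f (m + i :: nat))"
  for f :: "nat \<Rightarrow> 'a::comm_monoid_add"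
  by (induction n) (simp_all add: add.assoc)

lemma prod_lessThan_add: "prod f {..<m + n} = prod f {..<m} * (\<Prod>i<n. f (m + i :: nat))"
  for f :: "nat \<Rightarrow> 'a::comm_monoid_mult"
  by (induction n) (simp_all add: mult.assoc)

lemma homogeneous_poly_on_linear:
  assumes "linear_functional_on V l"
  shows "homogeneous_poly_on V 1 l"
  unfolding homogeneous_poly_on_def
  by (rule exI[of _ 1], rule exI[of _ "\<lambda>_. 1"], rule exI[of _ "\<lambda>_ _. l"]) (simp add: assms)

lemma homogeneous_poly_on_eval: "homogeneous_poly_on V 1 (\<lambda>F. F x)"
  by (rule homogeneous_poly_on_linear) (simp add: linear_functional_on_def)

lemma homogeneous_poly_on_add:
  assumes "homogeneous_poly_on V d P" "homogeneous_poly_on V d Q"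
  shows "homogeneous_poly_on V d (\<lambda>v. P v + Q v)"
proof -
  obtain m c l where P: "\<forall>i<(m::nat). \<forall>j<d. linear_functional_on V (l i j)"
    "\<forall>v\<in>V. P v = (\<Sum>i<m. c i * (\<Prod>j<d. l i j v))"
    using assms(1) unfolding homogeneous_poly_on_def by blast
  obtain m' c' l' where Q: "\<forall>i<(m'::nat). \<forall>j<d. linear_functional_on V (l' i j)"
    "\<forall>v\<in>V. Q v = (\<Sum>i<m'. c' i * (\<Prod>j<d. l' i j v))"
    using assms(2) unfolding homogeneous_poly_on_def by blast
  show ?thesis
    unfolding homogeneous_poly_on_def
    by (rule exI[of _ "m + m'"], rule exI[of _ "\<lambda>i. if i < m then c i else c' (i - m)"],
        rule exI[of _ "\<lambda>i. if i < m then l i else l' (i - m)"])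
      (use P Q in \<open>auto simp: sum_lessThan_add\<close>)
qed

lemma homogeneous_poly_on_cmult:
  assumes "homogeneous_poly_on V d P"
  shows "homogeneous_poly_on V d (\<lambda>v. c * P v)"
proof -
  obtain m e l where P: "\<forall>i<(m::nat). \<forall>j<d. linear_functional_on V (l i j)"
    "\<forall>v\<in>V. P v = (\<Sum>i<m. e i * (\<Prod>j<d. l i j v))"
    using assms(1) unfolding homogeneous_poly_on_def by blast
  show ?thesis
    unfolding homogeneous_poly_on_def
    by (rule exI[of _ m], rule exI[of _ "\<lambda>i. c * e i"], rule exI[of _ l])
      (use P in \<open>auto simp: sum_distrib_left mult.assoc\<close>)
qed

lemma homogeneous_poly_on_diff:
  assumes "homogeneous_poly_on V d P" "homogeneous_poly_on V d Q"
  shows "homogeneous_poly_on V d (\<lambda>v. P v - Q v)"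
  using homogeneous_poly_on_add[OF assms(1) homogeneous_poly_on_cmult[OF assms(2), of "-1"]] by simp

lemma homogeneous_poly_on_sum:
  assumes "\<And>i. i < (n::nat) \<Longrightarrow> homogeneous_poly_on V d (P i)"
  shows "homogeneous_poly_on V d (\<lambda>v. \<Sum>i<n. P i v)"
  using assms
proof (induction n)
  case 0
  show ?case
    unfolding homogeneous_poly_on_def by (rule exI[of _ 0]) simp
qed (simp add: homogeneous_poly_on_add)

text \<open>Expanding \<open>Q\<close> first reduces the claim to one product of \<open>e\<close>
  functionals, which is appended to every term of \<open>P\<close>.\<close>

lemma homogeneous_poly_on_mult:
  assumes "homogeneous_poly_on V d P" "homogeneous_poly_on V e Q"
  shows "homogeneous_poly_on V (d + e) (\<lambda>v. P v * Q v)"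
proof -
  obtain m c l where P: "\<forall>i<(m::nat). \<forall>j<d. linear_functional_on V (l i j)"
    "\<forall>v\<in>V. P v = (\<Sum>i<m. c i * (\<Prod>j<d. l i j v))"
    using assms(1) unfolding homogeneous_poly_on_def by blast
  obtain m' c' l' where Q: "\<forall>i<(m'::nat). \<forall>j<e. linear_functional_on V (l' i j)"
    "\<forall>v\<in>V. Q v = (\<Sum>i<m'. c' i * (\<Prod>j<e. l' i j v))"
    using assms(2) unfolding homogeneous_poly_on_def by blast
  have "homogeneous_poly_on V (d + e) (\<lambda>v. c' k * (P v * (\<Prod>j<e. l' k j v)))" if "k < m'" for k
  proof (rule homogeneous_poly_on_cmult)
    show "homogeneous_poly_on V (d + e) (\<lambda>v. P v * (\<Prod>j<e. l' k j v))"
      unfolding homogeneous_poly_on_def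
      by (rule exI[of _ m], rule exI[of _ c],
          rule exI[of _ "\<lambda>i j. if j < d then l i j else l' k (j - d)"])
        (use P Q that in \<open>auto simp: prod_lessThan_add sum_distrib_right mult.assoc\<close>)
  qed
  then have "homogeneous_poly_on V (d + e) (\<lambda>v. \<Sum>k<m'. c' k * (P v * (\<Prod>j<e. l' k j v)))"
    by (rule homogeneous_poly_on_sum)
  then show ?thesis
    by (rule homogeneous_poly_on_cong) (use Q in \<open>simp add: sum_distrib_left mult_ac\<close>)
qed

lemma homogeneous_poly_on_power:
  assumes "homogeneous_poly_on V d P"
  shows "homogeneous_poly_on V (d * n) (\<lambda>v. P v ^ n)"
proof (induction n)
  case 0
  show ?case
    unfolding homogeneous_poly_on_def
    by (rule exI[of _ 1], rule exI[of _ "\<lambda>_. 1"]) simp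
next
  case (Suc n)
  show ?case
    using homogeneous_poly_on_mult[OF assms Suc] by simp
qed

lemma homogeneous_poly_on_scale:
  assumes "homogeneous_poly_on V d P" "v \<in> V" "(\<lambda>x. c * v x) \<in> V"
  shows "P (\<lambda>x. c * v x) = c ^ d * P v"
proof -
  obtain m e l where P: "\<forall>i<(m::nat). \<forall>j<d. linear_functional_on V (l i j)"
    "\<forall>v\<in>V. P v = (\<Sum>i<m. e i * (\<Prod>j<d. l i j v))"
    using assms(1) unfolding homogeneous_poly_on_def by blast
  have "l i j (\<lambda>x. c * v x + 0 * v x) = c * l i j v + 0 * l i j v" if "i < m" "j < d" for i j
    using P(1) that assms(2) unfolding linear_functional_on_def by blast
  then have l: "l i j (\<lambda>x. c * v x) = c * l i j v" if "i < m" "j < d" for i j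
    using that by simp
  have "(\<Prod>j<d. l i j (\<lambda>x. c * v x)) = c ^ d * (\<Prod>j<d. l i j v)" if "i < m" for i
    using that by (simp add: l prod.distrib)
  then show ?thesis
    using P(2) assms(2,3) by (simp add: sum_distrib_left mult_ac)
qed

text \<open>The functionals in a homogeneous polynomial are merely linear on \<open>V_C7\<close>.
  Writing them in the basis of eight monomials is what yields continuity.\<close>

lemma linear_functional_on_form:
  assumes "linear_functional_on V_C7 l"
  shows "l (form a p q) = (\<Sum>k\<in>UNIV. a k * l (form (\<lambda>i. if i = k then 1 else 0) 0 0))
    + p * l (form (\<lambda>_. 0) 1 0) + q * l (form (\<lambda>_. 0) 0 1)"
proof -
  have l: "l (form (\<lambda>i. c * a i + e * b i) (c * p + e * p') (c * q + e * q')) =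
      c * l (form a p q) + e * l (form b p' q')" for c e a b p q p' q'
    using assms unfolding linear_functional_on_def by (metis form_lincomb form_in_V)
  have "l (form (\<lambda>i. if i \<in> S then a i else 0) p q) =
      (\<Sum>k\<in>S. a k * l (form (\<lambda>i. if i = k then 1 else 0) 0 0))
      + p * l (form (\<lambda>_. 0) 1 0) + q * l (form (\<lambda>_. 0) 0 1)" if "finite S" for S
    using that
  proof (induction S)
    case empty
    show ?case using l[of p "\<lambda>_. 0" q "\<lambda>_. 0" 1 0 0 1] by simp
  next
    case (insert k S)
    have "(\<lambda>i. if i \<in> insert k S then a i else 0) =
        (\<lambda>i. a k * (if i = k then 1 else 0) + 1 * (if i \<in> S then a i else 0))"
      using insert.hyps by auto
    then show ?case
      using l[of "a k" "\<lambda>i. if i = k then 1 else 0" 1 "\<lambda>i. if i \<in> S then a i else 0" 0 p 0 q]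
        insert by (simp add: add.assoc)
  qed
  from this[of UNIV] show ?thesis by simp
qed

lemma continuous_on_homogeneous_poly:
  assumes "homogeneous_poly_on V_C7 d P"
    and "\<And>i. continuous_on UNIV (\<lambda>t. a t i)" "continuous_on UNIV p" "continuous_on UNIV q"
  shows "continuous_on UNIV (\<lambda>t. P (form (a t) (p t) (q t)))"
proof -
  obtain m e l where P: "\<forall>i<(m::nat). \<forall>j<d. linear_functional_on V_C7 (l i j)"
    "\<forall>v\<in>V_C7. P v = (\<Sum>i<m. e i * (\<Prod>j<d. l i j v))"
    using assms(1) unfolding homogeneous_poly_on_def by blast
  have "continuous_on UNIV (\<lambda>t. l i j (form (a t) (p t) (q t)))" if "i < m" "j < d" for i j
  proof -
    have l: "linear_functional_on V_C7 (l i j)" using P(1) that by blast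
    have "(\<lambda>t. l i j (form (a t) (p t) (q t))) =
        (\<lambda>t. (\<Sum>k\<in>UNIV. a t k * l i j (form (\<lambda>i. if i = k then 1 else 0) 0 0))
          + p t * l i j (form (\<lambda>_. 0) 1 0) + q t * l i j (form (\<lambda>_. 0) 0 1))"
      by (rule ext) (rule linear_functional_on_form[OF l])
    moreover have "continuous_on UNIV \<dots>"
      by (intro continuous_intros assms)
    ultimately show ?thesis by (rule ssubst[where P = "continuous_on UNIV"])
  qed
  then have "continuous_on UNIV (\<lambda>t. \<Sum>i<m. e i * (\<Prod>j<d. l i j (form (a t) (p t) (q t))))"
    by (intro continuous_intros) auto
  then show ?thesis
    using P(2) by simp
qed

section \<open>Projective points and their orbits\<close>

lemma proj_point_eq_iff: "proj_point v = proj_point w \<longleftrightarrow> (\<exists>c. c \<noteq> 0 \<and> v = (\<lambda>x. c * w x))"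
proof
  assume "proj_point v = proj_point w"
  moreover have "v \<in> proj_point v"
    unfolding proj_point_def by (auto intro: exI[of _ 1])
  ultimately show "\<exists>c. c \<noteq> 0 \<and> v = (\<lambda>x. c * w x)"
    by (auto simp: proj_point_def)
next
  assume "\<exists>c. c \<noteq> 0 \<and> v = (\<lambda>x. c * w x)"
  then obtain c where c: "c \<noteq> 0" "v = (\<lambda>x. c * w x)" by blast
  show "proj_point v = proj_point w"
  proof (intro equalityI subsetI)
    fix y assume "y \<in> proj_point v"
    then obtain e where "e \<noteq> 0" "y = (\<lambda>x. (e * c) * w x)"
      using c(2) by (auto simp: proj_point_def mult.assoc)
    then show "y \<in> proj_point w"
      unfolding proj_point_def using c(1) by (intro CollectI exI[of _ "e * c"]) simp
  next
    fix y assume "y \<in> proj_point w"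
    then obtain e where "e \<noteq> 0" "y = (\<lambda>x. (e / c) * v x)"
      using c by (auto simp: proj_point_def)
    then show "y \<in> proj_point v"
      unfolding proj_point_def using c(1) by (intro CollectI exI[of _ "e / c"]) simp
  qed
qed

lemma homogeneous_poly_on_proj_zero_iff:
  assumes "homogeneous_poly_on V d P" "v \<in> V" "w \<in> V" "proj_point v = proj_point w"
  shows "P v = 0 \<longleftrightarrow> P w = 0"
proof -
  obtain c where "c \<noteq> 0" "v = (\<lambda>x. c * w x)"
    using assms(4) proj_point_eq_iff by blast
  then show ?thesis
    using homogeneous_poly_on_scale[of V d P w c] assms by simp
qed

lemma proj_act_proj_point: "change_vars A ` proj_point F = proj_point (change_vars A F)"
proof -
  have "change_vars A (\<lambda>x. c * F x) = (\<lambda>x. c * change_vars A F x)" for c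
    by (simp add: change_vars_def)
  then show ?thesis
    unfolding proj_point_def by (force simp: image_def)
qed

lemma change_vars_matrix_inv: "B \<in> carrier N_G1 \<Longrightarrow> change_vars (matrix_inv B) = pull B"
  by (simp add: change_vars_eq_pull matrix_inv_matrix_inv N_G1_det fun_eq_iff)

lemma pull_scale_cmat:
  "pull (cmat s (\<lambda>i. c * d i)) (form a p q) = (\<lambda>x. c ^ 3 * pull (cmat s d) (form a p q) x)"
proof -
  have 1: "b * (c * u * x)\<^sup>2 * (c * v * y) = c ^ 3 * (b * (u * x)\<^sup>2 * (v * y))"
    and 2: "b * (c * u * x) * (c * v * y) * (c * w * z) = c ^ 3 * (b * (u * x) * (v * y) * (w * z))"
    for b u v w x y z :: complex
    by (simp_all add: power2_eq_square power3_eq_cube)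
  show ?thesis
    unfolding pull_def form_def cmat_vector 1 2 by (simp only: sum_distrib_left distrib_left)
qed

text \<open>A scalar \<open>c\<close> multiplies a cubic form by \<open>c ^ 3\<close> and fixes its
  point, so the determinant condition drops out; closure under inverses absorbs
  \<open>matrix_inv\<close>.\<close>

lemma orbit_form:
  "orbit N_G1 (proj_act change_vars) (proj_point (form a p q)) =
     {proj_point (pull (cmat s d) (form a p q)) | s d. \<forall>i. d i \<noteq> 0}"
proof (intro equalityI subsetI)
  fix x assume "x \<in> orbit N_G1 (proj_act change_vars) (proj_point (form a p q))"
  then obtain A where A: "A \<in> carrier N_G1" "x = proj_point (change_vars A (form a p q))"
    unfolding orbit_def proj_act_proj_point by blast
  obtain s d where "matrix_inv A = cmat s d" "det (cmat s d) = 1"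
    using N_G1_imp_cmat N_G1_det matrix_inv_N_G1[OF A(1)] by metis
  then show "x \<in> {proj_point (pull (cmat s d) (form a p q)) | s d. \<forall>i. d i \<noteq> 0}"
    using A(2) det_cmat_eq_0_iff[of s d] unfolding change_vars_eq_pull by auto
next
  fix x assume "x \<in> {proj_point (pull (cmat s d) (form a p q)) | s d. \<forall>i. d i \<noteq> 0}"
  then obtain s d where d: "\<And>i. d i \<noteq> 0" and x: "x = proj_point (pull (cmat s d) (form a p q))"
    by blast
  obtain c where c: "c \<noteq> 0" "cmat s (\<lambda>i. c * d i) \<in> carrier N_G1"
    using scale_cmat_in_N_G1 d by blast
  have "x = proj_point (pull (cmat s (\<lambda>i. c * d i)) (form a p q))"
    unfolding x pull_scale_cmat using proj_point_eq_iff c(1) by (metis power_not_zero)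
  then show "x \<in> orbit N_G1 (proj_act change_vars) (proj_point (form a p q))"
    unfolding orbit_def proj_act_proj_point mem_Collect_eq
    using change_vars_matrix_inv[OF c(2)] matrix_inv_N_G1[OF c(2)] by metis
qed

section \<open>Semistability\<close>

lemma N_G1_actE:
  assumes "A \<in> carrier N_G1"
  obtains s d where "change_vars A = pull (cmat s d)" "(oprod d * eprod d)\<^sup>2 = 1"
proof -
  obtain s d where "matrix_inv A = cmat s d" "det (cmat s d) = 1"
    using N_G1_imp_cmat N_G1_det matrix_inv_N_G1[OF assms] by metis
  then show thesis
    using that[of s d] det_cmat_square[of s d] change_vars_eq_pull[of A]
    by (auto simp: prod_UNIV_6_eq)
qed

lemma homogeneous_poly_on_zero:
  assumes "homogeneous_poly_on V_C7 n P" "n > 0"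
  shows "P (\<lambda>_. 0) = 0"
proof -
  have "(\<lambda>_. 0) \<in> V_C7"
    using form_in_V[of "\<lambda>_. 0" 0 0] by (simp add: form_0)
  then show ?thesis
    using homogeneous_poly_on_scale[OF assms(1), of "\<lambda>_. 0" 0] assms(2) by (simp add: power_0_left)
qed

lemma homogeneous_poly_on_oprod: "homogeneous_poly_on V 3 (\<lambda>F. oprod (\<lambda>i. F (pt i)))"
  and homogeneous_poly_on_eprod: "homogeneous_poly_on V 3 (\<lambda>F. eprod (\<lambda>i. F (pt i)))"
proof -
  have "homogeneous_poly_on V (1 + 1 + 1) (\<lambda>F. F x * F y * F z)" for x y z
    by (intro homogeneous_poly_on_mult homogeneous_poly_on_eval)
  then have "homogeneous_poly_on V 3 (\<lambda>F. F x * F y * F z)" for x y z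
    by (simp add: eval_nat_numeral)
  then show "homogeneous_poly_on V 3 (\<lambda>F. oprod (\<lambda>i. F (pt i)))"
    "homogeneous_poly_on V 3 (\<lambda>F. eprod (\<lambda>i. F (pt i)))"
    unfolding oprod_def eprod_def by blast+
qed

lemmas homogeneous_poly_on_intros =
  homogeneous_poly_on_mult homogeneous_poly_on_add homogeneous_poly_on_diff
  homogeneous_poly_on_cmult homogeneous_poly_on_power homogeneous_poly_on_eval
  homogeneous_poly_on_oprod homogeneous_poly_on_eprod

text \<open>Even shifts act by the rule in \<open>torus\<close>, odd shifts by that rule combined
  with \<open>swap\<close>. The rule may use only \<open>(D * D')\<^sup>2 = 1\<close>: an odd shift
  is an odd permutation and forces \<open>D * D' = -1\<close>.\<close>

lemma invariant_formI:
  assumes "homogeneous_poly_on V_C7 n P"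
    and P: "\<And>a p q. P (form a p q) = \<Phi> (oprod a) (eprod a) p q"
    and torus: "\<And>x y p q D D'. (D * D')\<^sup>2 = 1 \<Longrightarrow>
      \<Phi> (x * D\<^sup>2 * D') (y * D'\<^sup>2 * D) (p * D) (q * D') = \<Phi> x y p q"
    and swap: "\<And>x y p q. \<Phi> y x q p = \<Phi> x y p q"
  shows "invariant_form N_G1 change_vars V_C7 n P"
proof -
  have "P (change_vars A v) = P v" if "A \<in> carrier N_G1" "v \<in> V_C7" for A v
  proof -
    obtain a p q where v: "v = form a p q"
      using \<open>v \<in> V_C7\<close> V_C7_imp_form by blast
    obtain s d where A: "change_vars A = pull (cmat s d)" and d: "(oprod d * eprod d)\<^sup>2 = 1"
      using N_G1_actE \<open>A \<in> carrier N_G1\<close> by blast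
    obtain a' p' q' where
      "pull (cmat s d) (form a p q) = form a' p' q'" and
      cases: "(s \<in> evens \<and> p' = p * oprod d \<and> q' = q * eprod d \<and>
         oprod a' = oprod a * (oprod d)\<^sup>2 * eprod d \<and> eprod a' = eprod a * (eprod d)\<^sup>2 * oprod d) \<or>
       (s \<in> odds \<and> p' = q * eprod d \<and> q' = p * oprod d \<and>
         oprod a' = eprod a * (eprod d)\<^sup>2 * oprod d \<and> eprod a' = oprod a * (oprod d)\<^sup>2 * eprod d)"
      by (rule pull_form)
    then have "P (change_vars A v) = \<Phi> (oprod a') (eprod a') p' q'"
      by (simp add: A v P)
    also have "\<dots> = \<Phi> (oprod a) (eprod a) p q"
      using cases torus[OF d] swap by metis
    finally show ?thesis by (simp add: v P)
  qed
  then show ?thesis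
    using assms(1) by (simp add: invariant_form_def)
qed

lemma git_semistableI:
  assumes "invariant_form N_G1 change_vars V_C7 n P" "n > 0" "F \<in> V_C7" "P F \<noteq> 0"
  shows "git_semistable N_G1 change_vars V_C7 F"
  using assms homogeneous_poly_on_zero[of n P]
  by (auto simp: git_semistable_def invariant_form_def)

lemma invariant_form_oprod_eprod:
  "invariant_form N_G1 change_vars V_C7 ((3 + 3) * 2)
     (\<lambda>F. (oprod (\<lambda>i. F (pt i)) * eprod (\<lambda>i. F (pt i)))\<^sup>2)"
proof (rule invariant_formI[where \<Phi> = "\<lambda>x y p q. (x * y)\<^sup>2"])
  fix x y D D' :: complex assume D: "(D * D')\<^sup>2 = 1"
  have "(x * D\<^sup>2 * D' * (y * D'\<^sup>2 * D))\<^sup>2 = (x * y)\<^sup>2 * ((D * D')\<^sup>2) ^ 3"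
    by algebra
  then show "(x * D\<^sup>2 * D' * (y * D'\<^sup>2 * D))\<^sup>2 = (x * y)\<^sup>2"
    unfolding D by simp
next
  show "homogeneous_poly_on V_C7 ((3 + 3) * 2) (\<lambda>F. (oprod (\<lambda>i. F (pt i)) * eprod (\<lambda>i. F (pt i)))\<^sup>2)"
    by (intro homogeneous_poly_on_intros)
qed (simp_all add: mult.commute)

lemma form_semistable:
  assumes "(p \<noteq> 0 \<and> q \<noteq> 0) \<or> (eprod a \<noteq> 0 \<and> p \<noteq> 0) \<or> (oprod a \<noteq> 0 \<and> q \<noteq> 0) \<or> (\<forall>i. a i \<noteq> 0)"
  shows "git_semistable N_G1 change_vars V_C7 (form a p q)"
proof -
  let ?O = "\<lambda>F. oprod (\<lambda>i. F (pt i))" and ?E = "\<lambda>F. eprod (\<lambda>i. F (pt i))"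
  \<comment> \<open>The degrees are left unevaluated so that they match the rules for products and
    powers.\<close>
  have inv1: "invariant_form N_G1 change_vars V_C7 ((1 + 1) * 2) (\<lambda>F. (F pt_odd * F pt_even)\<^sup>2)"
  proof (rule invariant_formI[where \<Phi> = "\<lambda>x y p q. (p * q)\<^sup>2"])
    fix p q D D' :: complex assume D: "(D * D')\<^sup>2 = 1"
    have "(p * D * (q * D'))\<^sup>2 = (p * q)\<^sup>2 * (D * D')\<^sup>2"
      by algebra
    then show "(p * D * (q * D'))\<^sup>2 = (p * q)\<^sup>2"
      unfolding D by simp
  next
    show "homogeneous_poly_on V_C7 ((1 + 1) * 2) (\<lambda>F. (F pt_odd * F pt_even)\<^sup>2)"
      by (intro homogeneous_poly_on_intros)
  qed (simp_all add: mult.commute)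
  have eq: "y * D'\<^sup>2 * D * (p * D) = y * p" "x * D\<^sup>2 * D' * (q * D') = x * q"
    if "(D * D')\<^sup>2 = 1" for x y p q D D' :: complex
  proof -
    have "y * D'\<^sup>2 * D * (p * D) = y * p * (D * D')\<^sup>2" "x * D\<^sup>2 * D' * (q * D') = x * q * (D * D')\<^sup>2"
      by algebra+
    then show "y * D'\<^sup>2 * D * (p * D) = y * p" "x * D\<^sup>2 * D' * (q * D') = x * q"
      unfolding that by simp_all
  qed
  have inv2: "invariant_form N_G1 change_vars V_C7 (3 + 1) (\<lambda>F. ?E F * F pt_odd + ?O F * F pt_even)"
  proof (rule invariant_formI[where \<Phi> = "\<lambda>x y p q. y * p + x * q"])
    show "homogeneous_poly_on V_C7 (3 + 1) (\<lambda>F. ?E F * F pt_odd + ?O F * F pt_even)"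
      by (intro homogeneous_poly_on_intros)
  qed (simp_all only: eq form_pt add.commute)
  have inv3: "invariant_form N_G1 change_vars V_C7 ((3 + 1) * 2)
      (\<lambda>F. (?E F * F pt_odd)\<^sup>2 + (?O F * F pt_even)\<^sup>2)"
  proof (rule invariant_formI[where \<Phi> = "\<lambda>x y p q. (y * p)\<^sup>2 + (x * q)\<^sup>2"])
    show "homogeneous_poly_on V_C7 ((3 + 1) * 2) (\<lambda>F. (?E F * F pt_odd)\<^sup>2 + (?O F * F pt_even)\<^sup>2)"
      by (intro homogeneous_poly_on_intros)
  qed (simp_all only: eq form_pt add.commute)
  consider "p * q \<noteq> 0" | "eprod a * p \<noteq> 0 \<or> oprod a * q \<noteq> 0" | "oprod a * eprod a \<noteq> 0"
    using assms oprod_eprod_neq_0[of a] by auto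
  then show ?thesis
  proof cases
    case 1
    then show ?thesis by (intro git_semistableI[OF inv1]) auto
  next
    case 2
    text \<open>The two monomials cannot have both vanishing sum and vanishing sum of squares.\<close>
    have "eprod a * p + oprod a * q \<noteq> 0 \<or> (eprod a * p)\<^sup>2 + (oprod a * q)\<^sup>2 \<noteq> 0"
    proof (rule ccontr)
      assume "\<not> ?thesis"
      then have "eprod a * p = - (oprod a * q)" "(eprod a * p)\<^sup>2 + (oprod a * q)\<^sup>2 = 0"
        by (auto simp: eq_neg_iff_add_eq_0)
      then have "2 * (oprod a * q)\<^sup>2 = 0" "2 * (eprod a * p)\<^sup>2 = 0" by algebra+
      then show False using 2 by simp
    qed
    then show ?thesis
      using git_semistableI[OF inv2, of "form a p q"] git_semistableI[OF inv3, of "form a p q"] by auto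
  next
    case 3
    then show ?thesis by (intro git_semistableI[OF invariant_form_oprod_eprod]) auto
  qed
qed

section \<open>One-parameter subgroups and their limits\<close>

definition onepar :: "(6 \<Rightarrow> int) \<Rightarrow> complex \<Rightarrow> complex^6^6" where
  "onepar r t = cmat 0 (\<lambda>i. t powi r i)"

lemma onepar_in_N_G1:
  assumes "sum r UNIV = 0" "t \<noteq> 0"
  shows "onepar r t \<in> carrier N_G1"
proof -
  have "(\<Prod>i\<in>S. t powi r i) = t powi sum r S" if "finite S" for S :: "6 set"
    using that assms(2) by induction (auto simp: power_int_add)
  then have "det (onepar r t) = 1"
    using assms(1) by (simp add: onepar_def det_cmat_0)
  then show ?thesis
    unfolding onepar_def by (rule cmat_in_N_G1)
qed

lemma pull_onepar:
  assumes "t \<noteq> 0"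
  shows "pull (onepar r t) (form a p q) = form (\<lambda>i. a i * t powi (2 * r i + r (i + 1)))
    (p * t powi (r 1 + r 3 + r 5)) (q * t powi (r 2 + r 4 + r 6))"
proof -
  have "(t powi r i)\<^sup>2 * t powi r (i + 1) = t powi (2 * r i + r (i + 1))" for i
  proof -
    have "2 * r i + r (i + 1) = r i + r i + r (i + 1)" by simp
    then show ?thesis
      using assms by (simp only: power_int_add power2_eq_square simp_thms)
  qed
  then have 1: "b * (t powi r i * x)\<^sup>2 * (t powi r (i + 1) * y) = b * t powi (2 * r i + r (i + 1)) * x\<^sup>2 * y"
    for b i x y
    by (simp add: power_mult_distrib mult_ac flip: \<open>\<And>i. (t powi r i)\<^sup>2 * t powi r (i + 1) = t powi (2 * r i + r (i + 1))\<close>)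
  have 2: "b * (t powi i * x) * (t powi j * y) * (t powi k * z) = b * t powi (i + j + k) * x * y * z"
    for b i j k x y z
    using assms by (simp add: power_int_add mult_ac)
  show ?thesis
    unfolding onepar_def pull_def form_def cmat_vector add_0_right 1 2 ..
qed

text \<open>The limit at \<open>t = 0\<close> of the orbit of \<open>form a p q\<close> under a one-parameter subgroup whose weights on
  it are nonnegative: exactly the terms of weight zero survive.\<close>

definition onepar_limit :: "(6 \<Rightarrow> int) \<Rightarrow> (6 \<Rightarrow> complex) \<Rightarrow> complex \<Rightarrow> complex \<Rightarrow> complex^6 \<Rightarrow> complex" where
  "onepar_limit r a p q = form (\<lambda>i. if 2 * r i + r (i + 1) = 0 then a i else 0)
     (if r 1 + r 3 + r 5 = 0 then p else 0) (if r 2 + r 4 + r 6 = 0 then q else 0)"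

definition nonneg_weights :: "(6 \<Rightarrow> int) \<Rightarrow> (6 \<Rightarrow> complex) \<Rightarrow> complex \<Rightarrow> complex \<Rightarrow> bool" where
  "nonneg_weights r a p q \<longleftrightarrow> (\<forall>i. a i \<noteq> 0 \<longrightarrow> 2 * r i + r (i + 1) \<ge> 0) \<and>
     (p \<noteq> 0 \<longrightarrow> r 1 + r 3 + r 5 \<ge> 0) \<and> (q \<noteq> 0 \<longrightarrow> r 2 + r 4 + r 6 \<ge> 0)"

text \<open>By continuity a value that is constant for \<open>t \<noteq> 0\<close> persists at the
  limit. This serves both for invariants and for the equations of a closed set.\<close>

lemma poly_onepar_limit:
  assumes "homogeneous_poly_on V_C7 n P" "nonneg_weights r a p q"
    and const: "\<And>t. t \<noteq> 0 \<Longrightarrow> P (pull (onepar r t) (form a p q)) = C"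
  shows "P (onepar_limit r a p q) = C"
proof -
  \<comment> \<open>Natural exponents make the curve defined and continuous at 0. Truncation by
    \<open>nat\<close> alters only negative weights, whose coefficients vanish.\<close>
  define f where "f = (\<lambda>t. P (form (\<lambda>i. a i * t ^ nat (2 * r i + r (i + 1)))
    (p * t ^ nat (r 1 + r 3 + r 5)) (q * t ^ nat (r 2 + r 4 + r 6))))"
  have "continuous_on UNIV f"
    unfolding f_def by (intro continuous_on_homogeneous_poly[OF assms(1)] continuous_intros)
  then have "(f \<longlongrightarrow> f 0) (at 0)"
    by (simp add: continuous_on_def)
  have pow: "c * t ^ nat w = c * t powi w" if "c \<noteq> 0 \<longrightarrow> w \<ge> 0" for c t :: complex and w
    using that by (auto simp: power_int_def)
  have "f t = C" if "t \<noteq> 0" for t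
    using const[OF that] assms(2) unfolding f_def pull_onepar[OF that] nonneg_weights_def
    by (simp add: pow)
  then have "eventually (\<lambda>t. f t = C) (at 0)"
    by (auto simp: eventually_at intro: exI[of _ 1])
  then have "(f \<longlongrightarrow> C) (at 0)"
    by (rule tendsto_eventually)
  with \<open>(f \<longlongrightarrow> f 0) (at 0)\<close> have "f 0 = C"
    by (rule tendsto_unique[rotated]) simp
  have zero: "c * 0 ^ nat w = (if w = 0 then c else 0)" if "c \<noteq> 0 \<longrightarrow> w \<ge> 0" for c :: complex and w
    using that by auto
  have "f 0 = P (onepar_limit r a p q)"
    using assms(2) unfolding f_def onepar_limit_def nonneg_weights_def by (simp add: zero)
  then show ?thesis using \<open>f 0 = C\<close> by simp
qed

lemma invariant_form_pull:
  assumes "invariant_form N_G1 change_vars V_C7 n P" "B \<in> carrier N_G1"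
  shows "P (pull B (form a p q)) = P (form a p q)"
  using assms change_vars_matrix_inv[of B] matrix_inv_N_G1[of B]
  unfolding invariant_form_def by (metis form_in_V)

lemma invariant_form_onepar_limit:
  assumes "invariant_form N_G1 change_vars V_C7 n P" "sum r UNIV = 0" "nonneg_weights r a p q"
  shows "P (onepar_limit r a p q) = P (form a p q)"
proof (rule poly_onepar_limit[OF _ assms(3)])
  show "homogeneous_poly_on V_C7 n P"
    using assms(1) by (simp add: invariant_form_def)
  show "P (pull (onepar r t) (form a p q)) = P (form a p q)" if "t \<noteq> 0" for t
    using invariant_form_pull[OF assms(1) onepar_in_N_G1[OF assms(2) that]] .
qed

lemma sum_UNIV_shift: "(\<Sum>i\<in>UNIV. f (i + s)) = sum f (UNIV :: 6 set)"
  by (rule sum.reindex_bij_witness[of _ "\<lambda>i. i - s" "\<lambda>i. i + s"]) auto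

lemma osum_shift:
  fixes f :: "6 \<Rightarrow> int"
  shows "s \<in> evens \<Longrightarrow> f (1 + s) + f (3 + s) + f (5 + s) = f 1 + f 3 + f 5"
    "s \<in> evens \<Longrightarrow> f (2 + s) + f (4 + s) + f (6 + s) = f 2 + f 4 + f 6"
    "s \<in> odds \<Longrightarrow> f (1 + s) + f (3 + s) + f (5 + s) = f 2 + f 4 + f 6"
    "s \<in> odds \<Longrightarrow> f (2 + s) + f (4 + s) + f (6 + s) = f 1 + f 3 + f 5"
  by (auto simp: numeral_6_reduce)

lemma shift_minus_eq_6_iff: "i + - j = 6 \<longleftrightarrow> i = (j::6)"
proof -
  have "i + - j = 6 \<longleftrightarrow> i + - j = 0"
    by (simp only: numeral_6_reduce)
  then show ?thesis by (simp add: add_eq_0_iff)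
qed

lemma form_not_semistable:
  assumes "\<not> ((p \<noteq> 0 \<and> q \<noteq> 0) \<or> (eprod a \<noteq> 0 \<and> p \<noteq> 0) \<or> (oprod a \<noteq> 0 \<and> q \<noteq> 0) \<or> (\<forall>i. a i \<noteq> 0))"
  shows "\<not> git_semistable N_G1 change_vars V_C7 (form a p q)"
proof
  assume "git_semistable N_G1 change_vars V_C7 (form a p q)"
  then obtain n P where P: "n > 0" "invariant_form N_G1 change_vars V_C7 n P" "P (form a p q) \<noteq> 0"
    unfolding git_semistable_def by blast
  \<comment> \<open>If \<open>p\<close> or \<open>q\<close> is nonzero, the failing conditions give
    a vanishing \<open>a j\<close> of the parity whose squarefree coefficient is 0; if both vanish,
    any vanishing \<open>a j\<close> will do.\<close>
  have "eprod a = 0 \<Longrightarrow> \<exists>j\<in>evens. a j = 0" "oprod a = 0 \<Longrightarrow> \<exists>j\<in>odds. a j = 0"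
    by (auto simp: oprod_def eprod_def)
  moreover have "evens \<inter> odds = {}" by auto
  ultimately obtain j where j: "a j = 0" "j \<in> evens \<Longrightarrow> q = 0" "j \<in> odds \<Longrightarrow> p = 0"
    using assms by (metis disjoint_iff)
  \<comment> \<open>The weights \<open>2 * u i + u (i + 1)\<close> are 3, 3, 3, 7, 1, -17, and the
    odd and even sums are 7 and -7. This suits the case \<open>a 6 = 0\<close>,
    \<open>q = 0\<close>.\<close>
  define u :: "6 \<Rightarrow> int" where "u = (\<lambda>i. (vector [1, 1, 1, 1, 5, -9] :: int^6) $ i)"
  have u: "u 1 = 1" "u 2 = 1" "u 3 = 1" "u 4 = 1" "u 5 = 5" "u 6 = -9"
    by (simp_all add: u_def vector_6)
  have "\<forall>i. i \<noteq> 6 \<longrightarrow> 2 * u i + u (i + 1) > 0"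
    unfolding forall_6 by (simp add: numeral_6_reduce u)
  then have u_pos: "i \<noteq> 6 \<Longrightarrow> 2 * u i + u (i + 1) > 0" for i
    by blast
  \<comment> \<open>Rotation moves the bad index 6 to \<open>j\<close>. For odd \<open>j\<close> it
    also exchanges the parity sums, so that the negative one meets \<open>p = 0\<close>.\<close>
  define r where "r = (\<lambda>i. u (i + - j))"
  have r_pos: "2 * r i + r (i + 1) > 0" if "a i \<noteq> 0" for i
    using u_pos[of "i + - j"] that j(1) shift_minus_eq_6_iff[of i j]
    by (auto simp: r_def algebra_simps)
  have odd: "r 1 + r 3 + r 5 > 0" if "p \<noteq> 0"
  proof -
    have "- j \<in> evens" using that j(3) evens_or_odds[of j] minus_in_evens by blast
    then show ?thesis
      using osum_shift(1)[of "- j" u] by (simp only: r_def u)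
  qed
  have even: "r 2 + r 4 + r 6 > 0" if "q \<noteq> 0"
  proof -
    have "- j \<in> odds" using that j(2) evens_or_odds[of j] minus_in_odds by blast
    then show ?thesis
      using osum_shift(4)[of "- j" u] by (simp only: r_def u)
  qed
  have "sum r UNIV = 0"
    unfolding r_def sum_UNIV_shift sum_6 u by simp
  moreover have "nonneg_weights r a p q"
    using r_pos odd even by (auto simp: nonneg_weights_def less_imp_le)
  ultimately have "P (onepar_limit r a p q) = P (form a p q)"
    using P(2) invariant_form_onepar_limit by blast
  moreover have "onepar_limit r a p q = (\<lambda>_. 0)"
  proof -
    have "a i = 0" if "2 * r i + r (i + 1) = 0" for i
      using r_pos[of i] that by force
    then show ?thesis
      unfolding onepar_limit_def form_0 [symmetric] form_eq_iff using odd even by force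
  qed
  ultimately show False
    using P homogeneous_poly_on_zero[of n P] by (auto simp: invariant_form_def)
qed

section \<open>Stability\<close>

lemma form_not_stable:
  assumes "a j = 0"
  shows "\<not> git_stable N_G1 change_vars V_C7 (form a p q)"
proof
  assume "git_stable N_G1 change_vars V_C7 (form a p q)"
  then obtain n P where
    fin: "finite (stabilizer N_G1 (proj_act change_vars) (proj_point (form a p q)))" and
    P: "n > 0" "invariant_form N_G1 change_vars V_C7 n P" "P (form a p q) \<noteq> 0" and
    closed: "\<forall>x \<in> nonvanishing_locus V_C7 P. \<exists>Z. zariski_closed V_C7 Z \<and>
      orbit N_G1 (proj_act change_vars) x = nonvanishing_locus V_C7 P \<inter> Z"
    unfolding git_stable_def by blast
  \<comment> \<open>From \<open>u 3 = 1\<close> on, each entry up to \<open>u 6\<close> is -2 times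
    the preceding one, which gives weight 0; \<open>u 1\<close> and \<open>u 2\<close> then make the
    odd and even sums vanish. The weights are 0, 21, 0, 0, 0, -21, and the sixth is again rotated to
    \<open>j\<close>.\<close>
  define u :: "6 \<Rightarrow> int" where "u = (\<lambda>i. (vector [-5, 10, 1, -2, 4, -8] :: int^6) $ i)"
  have u: "u 1 = -5" "u 2 = 10" "u 3 = 1" "u 4 = -2" "u 5 = 4" "u 6 = -8"
    by (simp_all add: u_def vector_6)
  have "\<forall>i. i \<noteq> 6 \<longrightarrow> 2 * u i + u (i + 1) \<ge> 0"
    unfolding forall_6 by (simp add: numeral_6_reduce u)
  then have u_nonneg: "i \<noteq> 6 \<Longrightarrow> 2 * u i + u (i + 1) \<ge> 0" for i
    by blast
  define r where "r = (\<lambda>i. u (i + - j))"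
  have "2 * r i + r (i + 1) \<ge> 0" if "a i \<noteq> 0" for i
    using u_nonneg[of "i + - j"] that assms shift_minus_eq_6_iff[of i j]
    by (auto simp: r_def algebra_simps)
  moreover have "r 1 + r 3 + r 5 = 0 \<and> r 2 + r 4 + r 6 = 0"
  proof (cases "- j \<in> evens")
    case True
    then show ?thesis
      using osum_shift(1,2)[of "- j" u] by (simp add: r_def u)
  next
    case False
    then have "- j \<in> odds" using evens_or_odds by blast
    then show ?thesis
      using osum_shift(3,4)[of "- j" u] by (simp add: r_def u)
  qed
  ultimately have r: "nonneg_weights r a p q"
    by (simp add: nonneg_weights_def)
  have r_sum: "sum r UNIV = 0"
    unfolding r_def sum_UNIV_shift sum_6 u by simp
  \<comment> \<open>Weight 1 at this index lets \<open>t\<close> be read off from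
    \<open>onepar r t\<close>, which later makes \<open>h\<close> injective.\<close>
  have r_3: "r (3 + j) = 1"
    by (simp add: r_def u)
  let ?F = "form a p q" and ?L = "onepar_limit r a p q"
  have L_V: "?L \<in> V_C7" by (simp add: onepar_limit_def)
  have N: "onepar r t \<in> carrier N_G1" if "t \<noteq> 0" for t
    using onepar_in_N_G1[OF r_sum that] .
  have hom: "homogeneous_poly_on V_C7 n P"
    using P(2) by (simp add: invariant_form_def)
  have nz: "P ?L \<noteq> 0"
    using P invariant_form_onepar_limit r r_sum by metis
  then have "proj_point ?L \<in> nonvanishing_locus V_C7 P"
    using L_V homogeneous_poly_on_zero[OF hom P(1)] by (auto simp: nonvanishing_locus_def)
  moreover have "proj_point ?F \<in> nonvanishing_locus V_C7 P"
    using P(3) homogeneous_poly_on_zero[OF hom P(1)] by (auto simp: nonvanishing_locus_def)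
  then obtain Z where Z: "zariski_closed V_C7 Z"
    "orbit N_G1 (proj_act change_vars) (proj_point ?F) = nonvanishing_locus V_C7 P \<inter> Z"
    using closed by blast
  moreover have "proj_point ?L \<in> Z"
  proof -
    obtain S where S: "\<forall>Q\<in>S. \<exists>d. homogeneous_poly_on V_C7 d Q"
      "Z = {proj_point v | v. v \<in> V_C7 \<and> v \<noteq> (\<lambda>_. 0) \<and> (\<forall>Q\<in>S. Q v = 0)}"
      using Z(1) unfolding zariski_closed_def by blast
    \<comment> \<open>The equations of \<open>Z\<close> vanish along the curve, which lies in the
      orbit, and hence at its limit.\<close>
    have "Q ?L = 0" if Q: "Q \<in> S" for Q
    proof -
      obtain d where d: "homogeneous_poly_on V_C7 d Q" using S(1) Q by blast
      have "Q (pull (onepar r t) ?F) = 0" if "t \<noteq> 0" for t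
      proof -
        have "proj_point (pull (onepar r t) ?F) \<in> orbit N_G1 (proj_act change_vars) (proj_point ?F)"
          using change_vars_matrix_inv[OF N[OF that]] matrix_inv_N_G1[OF N[OF that]]
          unfolding orbit_def proj_act_proj_point by (metis (mono_tags, lifting) mem_Collect_eq)
        then have "proj_point (pull (onepar r t) ?F) \<in> Z" using Z(2) by blast
        then obtain v where "v \<in> V_C7" "Q v = 0" "proj_point (pull (onepar r t) ?F) = proj_point v"
          using S(2) Q by blast
        moreover have "pull (onepar r t) ?F \<in> V_C7"
          by (simp add: pull_onepar[OF that])
        ultimately show ?thesis
          using homogeneous_poly_on_proj_zero_iff[OF d] by blast
      qed
      then show ?thesis
        using poly_onepar_limit[OF d r] by blast
    qed
    moreover have "?L \<noteq> (\<lambda>_. 0)"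
      using nz homogeneous_poly_on_zero[OF hom P(1)] by auto
    ultimately show ?thesis
      using S(2) L_V by blast
  qed
  ultimately have "proj_point ?L \<in> orbit N_G1 (proj_act change_vars) (proj_point ?F)"
    by blast
  then obtain g where g: "g \<in> carrier N_G1" "proj_point ?L = proj_point (change_vars g ?F)"
    unfolding orbit_def proj_act_proj_point by blast
  text \<open>The one-parameter subgroup fixes the limit, so a conjugate of it fixes \<open>F\<close>.\<close>
  define h where "h = (\<lambda>t. matrix_inv g ** matrix_inv (onepar r t) ** g)"
  have det_g: "det g = 1" using N_G1_det g(1) .
  have "h t \<in> stabilizer N_G1 (proj_act change_vars) (proj_point ?F)" if "t \<noteq> 0" for t
  proof -
    have "pull (onepar r t) ?L = ?L"
      unfolding onepar_limit_def pull_onepar[OF that] by (auto simp: form_eq_iff)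
    then have fix_L: "change_vars (matrix_inv (onepar r t)) ` proj_point ?L = proj_point ?L"
      unfolding proj_act_proj_point unfolding change_vars_matrix_inv[OF N[OF that]] by simp
    have mult: "change_vars (A ** B) F = change_vars A (change_vars B F)"
      if "A \<in> carrier N_G1" "B \<in> carrier N_G1" for A B F
    proof -
      have "(A ** B) ** (matrix_inv B ** matrix_inv A) = A ** (B ** matrix_inv B) ** matrix_inv A"
        by (simp only: matrix_mul_assoc)
      also have "\<dots> = mat 1"
        using that N_G1_det by (simp add: matrix_inv_mult)
      finally have "matrix_inv (A ** B) = matrix_inv B ** matrix_inv A"
        by (rule matrix_inv_eqI)
      then show ?thesis
        by (simp add: change_vars_eq_pull pull_pull)
    qed
    have h_N: "h t \<in> carrier N_G1"
      unfolding h_def by (intro mult_N_G1 matrix_inv_N_G1 g(1) N that)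
    have "proj_point (change_vars (h t) ?F) =
        change_vars (matrix_inv g) ` change_vars (matrix_inv (onepar r t)) ` change_vars g ` proj_point ?F"
      unfolding h_def proj_act_proj_point
      by (simp add: mult mult_N_G1 matrix_inv_N_G1 g(1) N that)
    also have "\<dots> = change_vars (matrix_inv g) ` change_vars g ` proj_point ?F"
      unfolding proj_act_proj_point[of g] g(2)[symmetric] fix_L ..
    also have "\<dots> = proj_point (change_vars (matrix_inv g ** g) ?F)"
      unfolding proj_act_proj_point by (simp add: mult matrix_inv_N_G1 g(1))
    also have "\<dots> = proj_point ?F"
      using det_g matrix_inv_eqI[of "mat 1 :: complex^6^6" "mat 1"]
      by (simp add: matrix_inv_mult change_vars_eq_pull)
    finally show ?thesis
      using h_N by (simp add: stabilizer_def proj_act_proj_point)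
  qed
  then have "finite (h ` {t. t \<noteq> 0})"
    using fin by (auto intro: finite_subset)
  moreover have "inj_on h {t. t \<noteq> 0}"
  proof (rule inj_onI)
    fix t t' assume t: "t \<in> {t. t \<noteq> 0}" "t' \<in> {t. t \<noteq> 0}" "h t = h t'"
    have "g ** h t ** matrix_inv g = matrix_inv (onepar r t)" for t
    proof -
      have "g ** h t ** matrix_inv g = (g ** matrix_inv g) ** matrix_inv (onepar r t) ** (g ** matrix_inv g)"
        by (simp only: h_def matrix_mul_assoc)
      then show ?thesis using det_g by (simp add: matrix_inv_mult)
    qed
    then have "matrix_inv (onepar r t) = matrix_inv (onepar r t')"
      using t(3) by metis
    then have "onepar r t = onepar r t'"
      using N t(1,2) N_G1_det matrix_inv_matrix_inv
      by (metis (mono_tags, lifting) mem_Collect_eq zero_neq_one)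
    then have "t powi r (3 + j) = t' powi r (3 + j)"
      unfolding onepar_def cmat_eq_iff by metis
    then show "t = t'" by (simp add: r_3)
  qed
  ultimately have "finite {t::complex. t \<noteq> 0}"
    by (rule finite_imageD)
  then have "finite (insert 0 {t::complex. t \<noteq> 0})" by simp
  moreover have "insert 0 {t::complex. t \<noteq> 0} = UNIV" by auto
  ultimately show False
    using infinite_UNIV_char_0[where 'a = complex] by simp
qed

section \<open>The cyclic system \<open>(d i)\<^sup>2 * d (i + 1) = e i\<close>\<close>

text \<open>The cyclic system \<open>d\<^sub>i\<^sup>2 d\<^sub>i\<^sub>+\<^sub>1 = e\<^sub>i\<close> determines \<open>d\<^sub>i\<close> up to a 63rd root of unity, since
  \<open>63 = 2\<^sup>6 - 1\<close>.\<close>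

definition elim_num :: "(6 \<Rightarrow> complex) \<Rightarrow> 6 \<Rightarrow> complex" where
  "elim_num e i = e (i + 4) ^ 2 * e (i + 2) ^ 8 * e i ^ 32"

definition elim_den :: "(6 \<Rightarrow> complex) \<Rightarrow> 6 \<Rightarrow> complex" where
  "elim_den e i = e (i + 5) * e (i + 3) ^ 4 * e (i + 1) ^ 16"

text \<open>Solving for \<open>d (i + 1)\<close>, then \<open>d (i + 2)\<close>, and so on round the
  cycle expresses \<open>d i\<close> by its own 64th power. The identity is this relation with
  denominators cleared and one factor \<open>d i\<close> cancelled.\<close>

lemma cyclic_system_power_63:
  "d i ^ 63 * elim_den (\<lambda>i. (d i)\<^sup>2 * d (i + 1)) i = elim_num (\<lambda>i. (d i)\<^sup>2 * d (i + 1)) i"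
proof -
  have 1: "i + 1 + 1 = i + 2" "i + 2 + 1 = i + 3" "i + 3 + 1 = i + 4" "i + 4 + 1 = i + 5" "i + 5 + 1 = i"
    by (simp_all add: add.assoc)
  have "x ^ 63 * x = x ^ 64" for x :: complex
    by (simp flip: power_Suc2)
  then show ?thesis
    unfolding elim_num_def elim_den_def 1
    by (simp add: power_mult_distrib power_mult [symmetric] mult_ac)
qed

lemma cyclic_system_solvable:
  fixes e :: "6 \<Rightarrow> complex"
  assumes e: "\<And>i. e i \<noteq> 0"
  obtains d where "\<And>i. d i \<noteq> 0" "\<And>i. (d i)\<^sup>2 * d (i + 1) = e i"
proof -
  obtain z where z: "z ^ 63 = elim_num e 6 / elim_den e 6"
    using exists_complex_root by (metis zero_neq_numeral)
  have nz: "elim_num e 6 \<noteq> 0" "elim_den e 6 \<noteq> 0"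
    using e by (simp_all add: elim_num_def elim_den_def)
  then have "z \<noteq> 0" using z by auto
  \<comment> \<open>With \<open>z\<close> as \<open>d 6\<close>, five of the equations hold by
    construction as the recursion goes round.\<close>
  define d1 where "d1 = e 6 / z\<^sup>2"
  define d2 where "d2 = e 1 / d1\<^sup>2"
  define d3 where "d3 = e 2 / d2\<^sup>2"
  define d4 where "d4 = e 3 / d3\<^sup>2"
  define d5 where "d5 = e 4 / d4\<^sup>2"
  define d where "d = (\<lambda>i. (vector [d1, d2, d3, d4, d5, z] :: complex^6) $ i)"
  have nz': "d1 \<noteq> 0" "d2 \<noteq> 0" "d3 \<noteq> 0" "d4 \<noteq> 0" "d5 \<noteq> 0"
    using e \<open>z \<noteq> 0\<close> by (simp_all add: d1_def d2_def d3_def d4_def d5_def)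
  have d: "d 1 = d1" "d 2 = d2" "d 3 = d3" "d 4 = d4" "d 5 = d5" "d 6 = z"
    by (simp_all add: d_def vector_6)
  have "\<forall>i. d i \<noteq> 0"
    unfolding forall_6 d using nz' \<open>z \<noteq> 0\<close> by simp
  moreover have rec: "(d 6)\<^sup>2 * d 1 = e 6" "(d 1)\<^sup>2 * d 2 = e 1" "(d 2)\<^sup>2 * d 3 = e 2"
    "(d 3)\<^sup>2 * d 4 = e 3" "(d 4)\<^sup>2 * d 5 = e 4"
    unfolding d using nz' \<open>z \<noteq> 0\<close> by (simp_all add: d1_def d2_def d3_def d4_def d5_def)
  \<comment> \<open>Among the factors of \<open>elim_num\<close> and \<open>elim_den\<close> at
    index 6, only \<open>e 5\<close> belongs to the unproved equation. Comparing the general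
    identity with the choice of \<open>z\<close> isolates it.\<close>
  moreover have "(d 5)\<^sup>2 * d 6 = e 5"
  proof -
    have "d 6 ^ 63 * ((d 5)\<^sup>2 * d 6 * e 3 ^ 4 * e 1 ^ 16) = elim_num e 6"
      using cyclic_system_power_63[of d 6]
      by (simp add: elim_num_def elim_den_def numeral_6_reduce rec)
    moreover have "d 6 ^ 63 * (e 5 * e 3 ^ 4 * e 1 ^ 16) = elim_num e 6"
      using z nz by (simp add: elim_den_def numeral_6_reduce d(6))
    ultimately have "d 6 ^ 63 * ((d 5)\<^sup>2 * d 6 * e 3 ^ 4 * e 1 ^ 16) = d 6 ^ 63 * (e 5 * e 3 ^ 4 * e 1 ^ 16)"
      by simp
    then show ?thesis
      using e \<open>z \<noteq> 0\<close> d(6) by simp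
  qed
  ultimately have "\<forall>i. (d i)\<^sup>2 * d (i + 1) = e i"
    unfolding forall_6 by (simp add: numeral_6_reduce)
  then show thesis using that[of d] \<open>\<forall>i. d i \<noteq> 0\<close> by blast
qed

text \<open>The solutions with right-hand side 1 are the powers of a 63rd root of unity
  \<open>y\<close> with exponents 1, -2, 4, -8, 16, -32. The odd exponents add up to 21 and the even
  ones to -42, and both powers of \<open>y\<close> equal \<open>\<eta>\<close> when
  \<open>y ^ 21 = \<eta>\<close>.\<close>

lemma cyclic_system_kernel:
  fixes \<eta> :: complex
  assumes "\<eta> ^ 3 = 1"
  obtains d where "\<And>i. d i \<noteq> 0" "\<And>i. (d i)\<^sup>2 * d (i + 1) = 1" "oprod d = \<eta>" "eprod d = \<eta>"
proof -
  obtain y where y: "y ^ 21 = \<eta>"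
    using exists_complex_root by (metis zero_neq_numeral)
  have "\<eta> \<noteq> 0" using assms by auto
  then have "y \<noteq> 0" using y by auto
  have y63: "y ^ 63 = 1"
    using assms unfolding y [symmetric] power_mult [symmetric] by simp
  define d where "d = (\<lambda>i. (vector [y, 1 / y ^ 2, y ^ 4, 1 / y ^ 8, y ^ 16, 1 / y ^ 32] :: complex^6) $ i)"
  have d: "d 1 = y" "d 2 = 1 / y ^ 2" "d 3 = y ^ 4" "d 4 = 1 / y ^ 8" "d 5 = y ^ 16" "d 6 = 1 / y ^ 32"
    by (simp_all add: d_def vector_6)
  have "\<forall>i. d i \<noteq> 0"
    unfolding forall_6 d using \<open>y \<noteq> 0\<close> by simp
  moreover have "y / (y ^ 32)\<^sup>2 = 1"
  proof -
    have "(y ^ 32)\<^sup>2 = y * y ^ 63"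
      by (simp flip: power_mult power_Suc)
    then show ?thesis using y63 \<open>y \<noteq> 0\<close> by simp
  qed
  then have "\<forall>i. (d i)\<^sup>2 * d (i + 1) = 1"
    unfolding forall_6 using \<open>y \<noteq> 0\<close>
    by (simp add: numeral_6_reduce d power_divide flip: power_mult)
  moreover have "oprod d = \<eta>"
    unfolding oprod_def d y [symmetric] by (simp flip: power_add power_Suc)
  moreover have "eprod d = \<eta>"
  proof -
    have "y ^ 2 * y ^ 8 * y ^ 32 = (y ^ 21)\<^sup>2"
      by (simp flip: power_add power_mult)
    then have "eprod d = 1 / \<eta>\<^sup>2"
      unfolding eprod_def d y by simp
    also have "\<dots> = \<eta>"
      using assms \<open>\<eta> \<noteq> 0\<close> by (simp add: field_simps power2_eq_square power3_eq_cube)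
    finally show ?thesis .
  qed
  ultimately show thesis using that[of d] by blast
qed

lemma pull_cmat_0:
  "pull (cmat 0 d) (form a p q) = form (\<lambda>i. a i * ((d i)\<^sup>2 * d (i + 1))) (p * oprod d) (q * eprod d)"
  by (simp add: pull_def form_def cmat_vector oprod_def eprod_def power_mult_distrib fun_eq_iff mult_ac)

lemma oprod_mult: "oprod (\<lambda>i. f i * g i) = oprod f * oprod g" "eprod (\<lambda>i. f i * g i) = eprod f * eprod g"
  by (simp_all add: oprod_def eprod_def mult_ac)

text \<open>A torus element first carries \<open>a\<close> to \<open>b\<close>. The equations then
  say that the transformed \<open>p\<close>, \<open>q\<close> agree with \<open>\<beta>\<close>,
  \<open>\<gamma>\<close> up to a common cube root of unity, which an element fixing all six
  coefficients corrects.\<close>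

lemma form_pull_cmat_0I:
  assumes nz: "\<And>i. a i \<noteq> 0" "\<And>i. b i \<noteq> 0"
    and inv: "\<beta> * \<gamma>\<^sup>2 * eprod a = p * q\<^sup>2 * eprod b" "\<beta>\<^sup>2 * \<gamma> * oprod a = p\<^sup>2 * q * oprod b"
      "\<beta> ^ 3 * eprod b * (oprod a)\<^sup>2 = p ^ 3 * eprod a * (oprod b)\<^sup>2"
      "\<gamma> ^ 3 * oprod b * (eprod a)\<^sup>2 = q ^ 3 * oprod a * (eprod b)\<^sup>2"
  shows "\<exists>d. (\<forall>i. d i \<noteq> 0) \<and> pull (cmat 0 d) (form a p q) = form b \<beta> \<gamma>"
proof -
  have "b i / a i \<noteq> 0" for i using nz by simp
  then obtain d where d: "\<And>i. d i \<noteq> 0" "\<And>i. (d i)\<^sup>2 * d (i + 1) = b i / a i"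
    using cyclic_system_solvable[of "\<lambda>i. b i / a i"] by blast
  define D where "D = oprod d"
  define D' where "D' = eprod d"
  have "b = (\<lambda>i. a i * (d i)\<^sup>2 * d (i + 1))"
    using d(2) nz by (simp add: fun_eq_iff mult.assoc)
  then have b: "oprod b = oprod a * D\<^sup>2 * D'" "eprod b = eprod a * D'\<^sup>2 * D"
    by (simp_all add: oprod_def eprod_def D_def D'_def numeral_6_reduce power_mult_distrib mult_ac)
  have D: "D \<noteq> 0" "D' \<noteq> 0"
    unfolding D_def D'_def using d(1) oprod_eprod_neq_0 by blast+
  have a: "oprod a \<noteq> 0" "eprod a \<noteq> 0"
    using nz(1) oprod_eprod_neq_0 by blast+
  define p0 where "p0 = p * D"
  define q0 where "q0 = q * D'"
  have "eprod a * (\<beta> * \<gamma>\<^sup>2) = eprod a * (p0 * q0\<^sup>2)"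
    using inv(1) unfolding b p0_def q0_def by algebra
  then have 1: "\<beta> * \<gamma>\<^sup>2 = p0 * q0\<^sup>2" using a by simp
  have "oprod a * (\<beta>\<^sup>2 * \<gamma>) = oprod a * (p0\<^sup>2 * q0)"
    using inv(2) unfolding b p0_def q0_def by algebra
  then have 2: "\<beta>\<^sup>2 * \<gamma> = p0\<^sup>2 * q0" using a by simp
  have "(eprod a * (oprod a)\<^sup>2 * D'\<^sup>2 * D) * \<beta> ^ 3 = (eprod a * (oprod a)\<^sup>2 * D'\<^sup>2 * D) * p0 ^ 3"
    using inv(3) unfolding b p0_def by algebra
  then have 3: "\<beta> ^ 3 = p0 ^ 3" using a D by simp
  have "(oprod a * (eprod a)\<^sup>2 * D\<^sup>2 * D') * \<gamma> ^ 3 = (oprod a * (eprod a)\<^sup>2 * D\<^sup>2 * D') * q0 ^ 3"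
    using inv(4) unfolding b q0_def by algebra
  then have 4: "\<gamma> ^ 3 = q0 ^ 3" using a D by simp
  \<comment> \<open>The mixed equations make the two cube roots equal when both coefficients are
    nonzero; if one is zero, the root comes from the cube of the other.\<close>
  obtain \<eta> where \<eta>: "\<eta> ^ 3 = 1" "\<beta> = p0 * \<eta>" "\<gamma> = q0 * \<eta>"
  proof (cases "p0 = 0")
    case True
    then have "\<beta> = 0" using 3 by simp
    show thesis
    proof (cases "q0 = 0")
      case True
      then show thesis using that[of 1] 4 \<open>\<beta> = 0\<close> \<open>p0 = 0\<close> by simp
    next
      case False
      then show thesis using that[of "\<gamma> / q0"] 4 \<open>\<beta> = 0\<close> \<open>p0 = 0\<close> by (simp add: power_divide)
    qed
  next
    case False
    define \<eta> where "\<eta> = \<beta> / p0"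
    have \<eta>: "\<eta> ^ 3 = 1" "\<beta> = p0 * \<eta>"
      using False 3 by (simp_all add: \<eta>_def power_divide)
    have "p0\<^sup>2 * (\<eta>\<^sup>2 * \<gamma>) = p0\<^sup>2 * q0"
      using 2 unfolding \<eta>(2) by (simp add: power_mult_distrib mult_ac)
    then have "\<eta>\<^sup>2 * \<gamma> = q0" using False by simp
    moreover have "\<eta>\<^sup>2 * \<gamma> * \<eta> = \<eta> ^ 3 * \<gamma>"
      by (simp add: power2_eq_square power3_eq_cube)
    ultimately have "\<gamma> = q0 * \<eta>" using \<eta>(1) by simp
    then show thesis using that \<eta> by blast
  qed
  obtain d' where d': "\<And>i. d' i \<noteq> 0" "\<And>i. (d' i)\<^sup>2 * d' (i + 1) = 1" "oprod d' = \<eta>" "eprod d' = \<eta>"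
    using cyclic_system_kernel[OF \<eta>(1)] by blast
  have "(d i * d' i)\<^sup>2 * (d (i + 1) * d' (i + 1)) = (b i / a i) * 1" for i
    unfolding d(2) [symmetric] d'(2) [of i, symmetric] by (simp add: power_mult_distrib mult_ac)
  then have "(\<lambda>i. a i * ((d i * d' i)\<^sup>2 * (d (i + 1) * d' (i + 1)))) = b"
    using nz by simp
  moreover have "oprod (\<lambda>i. d i * d' i) = D * \<eta>" "eprod (\<lambda>i. d i * d' i) = D' * \<eta>"
    by (simp_all add: oprod_mult D_def D'_def d'(3,4))
  ultimately have "pull (cmat 0 (\<lambda>i. d i * d' i)) (form a p q) = form b \<beta> \<gamma>"
    unfolding pull_cmat_0 by (simp add: \<eta> p0_def q0_def mult_ac)
  then show ?thesis
    using d(1) d'(1) by (intro exI[of _ "\<lambda>i. d i * d' i"]) simp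
qed

text \<open>Fixing the point means multiplying the form by some \<open>c\<close>. The determinant
  allows finitely many \<open>c\<close>, hence finitely many right-hand sides of the cyclic system,
  each with finitely many solutions.\<close>

lemma finite_stabilizer_form:
  assumes nz: "\<And>i. a i \<noteq> 0"
  shows "finite (stabilizer N_G1 (proj_act change_vars) (proj_point (form a p q)))"
proof -
  \<comment> \<open>The right-hand side of the system for \<open>d\<close>, from equating the
    coefficient at \<open>i + s\<close> of the pulled-back form with
    \<open>c * a (i + s)\<close>.\<close>
  define e where "e = (\<lambda>s c i. c * a (i + s) / a i)"
  define E where "E = (\<Union>s\<in>UNIV. \<Union>c\<in>{c. c ^ 12 = 1}. \<Union>i\<in>UNIV.
    {z. z ^ 63 = elim_num (e s c) i / elim_den (e s c) i})"
  have "finite E"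
    unfolding E_def by (intro finite_UN_I finite_nth_roots finite) simp_all
  then have "finite (PiE (UNIV :: 6 set) (\<lambda>_. E))"
    by (intro finite_PiE) auto
  then have "finite ((\<lambda>(s, d). matrix_inv (cmat s d)) ` (UNIV \<times> PiE UNIV (\<lambda>_. E)))"
    by simp
  moreover have "A \<in> (\<lambda>(s, d). matrix_inv (cmat s d)) ` (UNIV \<times> PiE UNIV (\<lambda>_. E))"
    if "A \<in> stabilizer N_G1 (proj_act change_vars) (proj_point (form a p q))" for A
  proof -
    have A: "A \<in> carrier N_G1" "proj_point (change_vars A (form a p q)) = proj_point (form a p q)"
      using that by (simp_all add: stabilizer_def proj_act_proj_point)
    obtain s d where d: "matrix_inv A = cmat s d" "det (cmat s d) = 1"
      using N_G1_imp_cmat N_G1_det matrix_inv_N_G1[OF A(1)] by metis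
    have D: "(oprod d * eprod d)\<^sup>2 = 1"
      using det_cmat_square[of s d] d(2) by (simp add: prod_UNIV_6_eq)
    obtain c where c: "c \<noteq> 0" "pull (cmat s d) (form a p q) = (\<lambda>x. c * form a p q x)"
      using A(2) by (auto simp: proj_point_eq_iff change_vars_eq_pull d(1))
    obtain a' p' q' where a': "pull (cmat s d) (form a p q) = form a' p' q'"
      "\<And>i. a' (i + s) = a i * (d i)\<^sup>2 * d (i + 1)" and
      cases: "(s \<in> evens \<and> p' = p * oprod d \<and> q' = q * eprod d \<and>
         oprod a' = oprod a * (oprod d)\<^sup>2 * eprod d \<and> eprod a' = eprod a * (eprod d)\<^sup>2 * oprod d) \<or>
       (s \<in> odds \<and> p' = q * eprod d \<and> q' = p * oprod d \<and>
         oprod a' = eprod a * (eprod d)\<^sup>2 * oprod d \<and> eprod a' = oprod a * (oprod d)\<^sup>2 * eprod d)"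
      by (rule pull_form) (rule that)
    have a'_eq: "a' = (\<lambda>i. c * a i)"
      using a'(1) c(2) by (simp add: form_scale form_eq_iff)
    \<comment> \<open>Computing the product of all six coefficients in two ways gives
      \<open>c ^ 6 = (oprod d * eprod d) ^ 3\<close>, and squaring removes the unknown sign.\<close>
    have "oprod a' * eprod a' = oprod a * eprod a * (oprod d * eprod d) ^ 3"
      using cases by (elim disjE conjE) (simp_all add: power2_eq_square power3_eq_cube mult_ac)
    moreover have "oprod a' * eprod a' = oprod a * eprod a * c ^ 6"
      unfolding a'_eq oprod_def eprod_def by (simp add: power_numeral_reduce)
    moreover have "oprod a * eprod a \<noteq> 0"
      using nz oprod_eprod_neq_0[of a] by simp
    ultimately have "c ^ 6 = (oprod d * eprod d) ^ 3" by simp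
    moreover have "c ^ 12 = (c ^ 6)\<^sup>2" by (simp flip: power_mult)
    moreover have "((oprod d * eprod d) ^ 3)\<^sup>2 = ((oprod d * eprod d)\<^sup>2) ^ 3"
      by (simp only: power_mult [symmetric] mult.commute)
    ultimately have c12: "c ^ 12 = 1" using D by simp
    have "(d i)\<^sup>2 * d (i + 1) = e s c i" for i
      using a'(2)[of i] nz[of i] unfolding a'_eq e_def by (simp add: field_simps)
    then have sys: "(\<lambda>i. (d i)\<^sup>2 * d (i + 1)) = e s c" by blast
    have "d i \<in> E" for i
    proof -
      have "e s c i \<noteq> 0" for i
        using nz c(1) by (simp add: e_def)
      then have "elim_den (e s c) i \<noteq> 0"
        by (simp add: elim_den_def)
      then have "d i ^ 63 = elim_num (e s c) i / elim_den (e s c) i"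
        using cyclic_system_power_63[of d i] unfolding sys by (simp add: field_simps)
      then show ?thesis
        unfolding E_def using c12 by blast
    qed
    then have "d \<in> PiE UNIV (\<lambda>_. E)" by auto
    moreover have "A = matrix_inv (cmat s d)"
      using matrix_inv_matrix_inv[of A] N_G1_det[OF A(1)] d(1) by simp
    ultimately show ?thesis by force
  qed
  ultimately show ?thesis
    by (meson finite_subset subsetI)
qed

section \<open>Equations of the orbits, and stability\<close>

text \<open>The equations of the orbit of \<open>form a p q\<close> under the full diagonal torus, inside the locus
  where no coefficient \<open>a i\<close> vanishes. Here \<open>x\<close> and \<open>y\<close> stand for \<open>oprod a\<close> and \<open>eprod a\<close>; a cyclic
  shift by an odd number exchanges \<open>x\<close> with \<open>y\<close> and \<open>p\<close> with \<open>q\<close>.\<close>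

definition orbit_eqs ::
    "complex \<Rightarrow> complex \<Rightarrow> complex \<Rightarrow> complex \<Rightarrow> ((complex^6 \<Rightarrow> complex) \<Rightarrow> complex) set" where
  "orbit_eqs x y p q =
    {\<lambda>F. y * (F pt_odd * (F pt_even)\<^sup>2) - p * q\<^sup>2 * eprod (\<lambda>i. F (pt i)),
     \<lambda>F. x * ((F pt_odd)\<^sup>2 * F pt_even) - p\<^sup>2 * q * oprod (\<lambda>i. F (pt i)),
     \<lambda>F. x\<^sup>2 * (F pt_odd ^ 3 * eprod (\<lambda>i. F (pt i))) - p ^ 3 * y * (oprod (\<lambda>i. F (pt i)))\<^sup>2,
     \<lambda>F. y\<^sup>2 * (F pt_even ^ 3 * oprod (\<lambda>i. F (pt i))) - q ^ 3 * x * (eprod (\<lambda>i. F (pt i)))\<^sup>2}"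

lemma homogeneous_orbit_eqs:
  assumes "f \<in> orbit_eqs x y p q"
  shows "\<exists>n. homogeneous_poly_on V n f"
proof -
  have "homogeneous_poly_on V (1 + 1 * 2) (\<lambda>F. F u * (F w)\<^sup>2)"
    "homogeneous_poly_on V (1 * 2 + 1) (\<lambda>F. (F u)\<^sup>2 * F w)"
    "homogeneous_poly_on V (1 * 3 + 3) (\<lambda>F. F u ^ 3 * eprod (\<lambda>i. F (pt i)))"
    "homogeneous_poly_on V (1 * 3 + 3) (\<lambda>F. F u ^ 3 * oprod (\<lambda>i. F (pt i)))"
    "homogeneous_poly_on V (3 * 2) (\<lambda>F. (eprod (\<lambda>i. F (pt i)))\<^sup>2)"
    "homogeneous_poly_on V (3 * 2) (\<lambda>F. (oprod (\<lambda>i. F (pt i)))\<^sup>2)" for u w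
    by (intro homogeneous_poly_on_intros)+
  then have monomials: "homogeneous_poly_on V 3 (\<lambda>F. F u * (F w)\<^sup>2)"
    "homogeneous_poly_on V 3 (\<lambda>F. (F u)\<^sup>2 * F w)"
    "homogeneous_poly_on V 6 (\<lambda>F. F u ^ 3 * eprod (\<lambda>i. F (pt i)))"
    "homogeneous_poly_on V 6 (\<lambda>F. F u ^ 3 * oprod (\<lambda>i. F (pt i)))"
    "homogeneous_poly_on V 6 (\<lambda>F. (eprod (\<lambda>i. F (pt i)))\<^sup>2)"
    "homogeneous_poly_on V 6 (\<lambda>F. (oprod (\<lambda>i. F (pt i)))\<^sup>2)" for u w
    by (simp_all del: One_nat_def)
  have
    "homogeneous_poly_on V 3 (\<lambda>F. y * (F pt_odd * (F pt_even)\<^sup>2) - p * q\<^sup>2 * eprod (\<lambda>i. F (pt i)))"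
    "homogeneous_poly_on V 3 (\<lambda>F. x * ((F pt_odd)\<^sup>2 * F pt_even) - p\<^sup>2 * q * oprod (\<lambda>i. F (pt i)))"
    "homogeneous_poly_on V 6
      (\<lambda>F. x\<^sup>2 * (F pt_odd ^ 3 * eprod (\<lambda>i. F (pt i))) - p ^ 3 * y * (oprod (\<lambda>i. F (pt i)))\<^sup>2)"
    "homogeneous_poly_on V 6
      (\<lambda>F. y\<^sup>2 * (F pt_even ^ 3 * oprod (\<lambda>i. F (pt i))) - q ^ 3 * x * (eprod (\<lambda>i. F (pt i)))\<^sup>2)"
    by (intro homogeneous_poly_on_diff homogeneous_poly_on_cmult monomials
        homogeneous_poly_on_oprod homogeneous_poly_on_eprod)+
  then show ?thesis
    using assms unfolding orbit_eqs_def by auto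
qed

text \<open>Brings the equations into the shape of the hypotheses of
  \<open>form_pull_cmat_0I\<close>.\<close>

lemma orbit_eqs_form:
  "(\<forall>f\<in>orbit_eqs x y p q. f (form b \<beta> \<gamma>) = 0) \<longleftrightarrow>
     \<beta> * \<gamma>\<^sup>2 * y = p * q\<^sup>2 * eprod b \<and> \<beta>\<^sup>2 * \<gamma> * x = p\<^sup>2 * q * oprod b \<and>
     \<beta> ^ 3 * eprod b * x\<^sup>2 = p ^ 3 * y * (oprod b)\<^sup>2 \<and>
     \<gamma> ^ 3 * oprod b * y\<^sup>2 = q ^ 3 * x * (eprod b)\<^sup>2"
  by (simp add: orbit_eqs_def mult_ac)

text \<open>In each equation both monomials scale by the same character: D D'^2, D^2 D', D^4 D'^2
  and D^2 D'^4 respectively.\<close>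

lemma orbit_eqs_torus:
  "f \<in> orbit_eqs x y p q \<Longrightarrow> oprod b = x * D\<^sup>2 * D' \<Longrightarrow> eprod b = y * D'\<^sup>2 * D \<Longrightarrow>
    f (form b (p * D) (q * D')) = 0"
proof -
  assume b: "oprod b = x * D\<^sup>2 * D'" "eprod b = y * D'\<^sup>2 * D"
  have "\<forall>f\<in>orbit_eqs x y p q. f (form b (p * D) (q * D')) = 0"
    unfolding orbit_eqs_form b by (intro conjI; algebra)
  then show "f \<in> orbit_eqs x y p q \<Longrightarrow> f (form b (p * D) (q * D')) = 0" by blast
qed

lemma form_stable:
  assumes nz: "\<And>i. a i \<noteq> 0"
  shows "git_stable N_G1 change_vars V_C7 (form a p q)"
proof -
  define P :: "(complex^6 \<Rightarrow> complex) \<Rightarrow> complex"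
    where "P = (\<lambda>F. (oprod (\<lambda>i. F (pt i)) * eprod (\<lambda>i. F (pt i)))\<^sup>2)"
  have P_form: "P (form b \<beta> \<gamma>) \<noteq> 0 \<longleftrightarrow> (\<forall>i. b i \<noteq> 0)" for b \<beta> \<gamma>
    using oprod_eprod_neq_0[of b] by (auto simp: P_def)
  have inv: "invariant_form N_G1 change_vars V_C7 12 P"
    using invariant_form_oprod_eprod by (simp add: P_def)
  then have hom: "homogeneous_poly_on V_C7 12 P"
    by (simp add: invariant_form_def)
  have P_0: "P (\<lambda>_. 0) = 0"
    using homogeneous_poly_on_zero[OF hom] by simp
  have closed: "\<exists>Z. zariski_closed V_C7 Z \<and>
      orbit N_G1 (proj_act change_vars) x = nonvanishing_locus V_C7 P \<inter> Z"
    if x: "x \<in> nonvanishing_locus V_C7 P" for x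
  proof -
    obtain v where v: "v \<in> V_C7" "P v \<noteq> 0" "x = proj_point v"
      using x unfolding nonvanishing_locus_def by blast
    \<comment> \<open>These coefficients belong to the arbitrary point \<open>x\<close> of the locus
      and shadow those of the lemma.\<close>
    then obtain a p q where a: "v = form a p q"
      using V_C7_imp_form by blast
    then have a_nz: "\<And>i. a i \<noteq> 0" using v(2) P_form by blast
    define I where "I = orbit_eqs (oprod a) (eprod a) p q"
    define J where "J = orbit_eqs (eprod a) (oprod a) q p"
    \<comment> \<open>Products of one equation from each system cut out the union of the two closed
      sets.\<close>
    define S where "S = {Q. \<exists>f\<in>I. \<exists>g\<in>J. Q = (\<lambda>F. f F * g F)}"
    define Z where "Z = {proj_point v | v. v \<in> V_C7 \<and> v \<noteq> (\<lambda>_. 0) \<and> (\<forall>Q\<in>S. Q v = 0)}"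
    have S_hom: "\<exists>n. homogeneous_poly_on V_C7 n Q" if Q_in: "Q \<in> S" for Q
    proof -
      obtain f g where Q: "Q = (\<lambda>F. f F * g F)" "f \<in> I" "g \<in> J"
        using Q_in unfolding S_def by blast
      then obtain m n where "homogeneous_poly_on V_C7 m f" "homogeneous_poly_on V_C7 n g"
        using homogeneous_orbit_eqs unfolding I_def J_def by metis
      then show ?thesis
        unfolding Q(1) using homogeneous_poly_on_mult by blast
    qed
    have S_zero: "(\<forall>Q\<in>S. Q w = 0) \<longleftrightarrow> (\<forall>f\<in>I. f w = 0) \<or> (\<forall>g\<in>J. g w = 0)" for w
    proof -
      have "(\<forall>Q\<in>S. Q w = 0) \<longleftrightarrow> (\<forall>f\<in>I. \<forall>g\<in>J. f w * g w = 0)"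
      proof (intro iffI ballI)
        fix f g assume Q: "\<forall>Q\<in>S. Q w = 0" and "f \<in> I" "g \<in> J"
        then have "(\<lambda>F. f F * g F) \<in> S"
          unfolding S_def by (intro CollectI bexI[of _ f] bexI[of _ g]) simp_all
        then show "f w * g w = 0"
          using Q by fast
      next
        fix Q assume fg: "\<forall>f\<in>I. \<forall>g\<in>J. f w * g w = 0" and "Q \<in> S"
        then obtain f g where "Q = (\<lambda>F. f F * g F)" "f \<in> I" "g \<in> J"
          unfolding S_def by blast
        then show "Q w = 0" using fg by auto
      qed
      then show ?thesis by auto
    qed
    have "orbit N_G1 (proj_act change_vars) x = nonvanishing_locus V_C7 P \<inter> Z"
    proof (intro equalityI subsetI)
      fix y assume "y \<in> orbit N_G1 (proj_act change_vars) x"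
      then obtain s d where d: "\<And>i. d i \<noteq> 0" and y: "y = proj_point (pull (cmat s d) (form a p q))"
        unfolding v(3) a orbit_form by blast
      obtain a' p' q' where a': "pull (cmat s d) (form a p q) = form a' p' q'"
        "\<And>i. a' (i + s) = a i * (d i)\<^sup>2 * d (i + 1)" and
        cases: "(s \<in> evens \<and> p' = p * oprod d \<and> q' = q * eprod d \<and>
           oprod a' = oprod a * (oprod d)\<^sup>2 * eprod d \<and> eprod a' = eprod a * (eprod d)\<^sup>2 * oprod d) \<or>
         (s \<in> odds \<and> p' = q * eprod d \<and> q' = p * oprod d \<and>
           oprod a' = eprod a * (eprod d)\<^sup>2 * oprod d \<and> eprod a' = oprod a * (oprod d)\<^sup>2 * eprod d)"
        by (rule pull_form) (rule that)
      have "(\<forall>f\<in>I. f (form a' p' q') = 0) \<or> (\<forall>g\<in>J. g (form a' p' q') = 0)"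
        using cases
      proof
        assume "s \<in> evens \<and> p' = p * oprod d \<and> q' = q * eprod d \<and>
          oprod a' = oprod a * (oprod d)\<^sup>2 * eprod d \<and> eprod a' = eprod a * (eprod d)\<^sup>2 * oprod d"
        then show ?thesis
          using orbit_eqs_torus[of _ "oprod a" "eprod a" p q a' "oprod d" "eprod d"]
          unfolding I_def by blast
      next
        assume "s \<in> odds \<and> p' = q * eprod d \<and> q' = p * oprod d \<and>
          oprod a' = eprod a * (eprod d)\<^sup>2 * oprod d \<and> eprod a' = oprod a * (oprod d)\<^sup>2 * eprod d"
        then show ?thesis
          using orbit_eqs_torus[of _ "eprod a" "oprod a" q p a' "eprod d" "oprod d"]
          unfolding J_def by blast
      qed
      moreover have "P (form a' p' q') \<noteq> 0"
      proof -
        have "a' i \<noteq> 0" for i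
          using a'(2)[of "i - s"] a_nz d by simp
        then show ?thesis using P_form by blast
      qed
      moreover from this have "form a' p' q' \<noteq> (\<lambda>_. 0)"
        using P_0 by metis
      ultimately show "y \<in> nonvanishing_locus V_C7 P \<inter> Z"
        unfolding y a'(1) nonvanishing_locus_def Z_def S_zero using form_in_V by blast
    next
      fix y assume "y \<in> nonvanishing_locus V_C7 P \<inter> Z"
      then obtain w w' where w: "w \<in> V_C7" "P w \<noteq> 0" "y = proj_point w"
        and w': "w' \<in> V_C7" "\<forall>Q\<in>S. Q w' = 0" "y = proj_point w'"
        unfolding nonvanishing_locus_def Z_def by blast
      \<comment> \<open>Membership in \<open>Z\<close> comes with another representative
        \<open>w'\<close>; homogeneity transfers its zeros to \<open>w\<close>.\<close>
      have "\<forall>Q\<in>S. Q w = 0"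
      proof
        fix Q assume "Q \<in> S"
        then show "Q w = 0"
          using S_hom homogeneous_poly_on_proj_zero_iff[OF _ w(1) w'(1)] w(3) w'(2,3) by blast
      qed
      obtain b \<beta> \<gamma> where b: "w = form b \<beta> \<gamma>"
        using w(1) V_C7_imp_form by blast
      have b_nz: "\<And>i. b i \<noteq> 0" using w(2) P_form b by blast
      have "\<exists>s d. (\<forall>i. d i \<noteq> 0) \<and> pull (cmat s d) (form a p q) = w"
        using \<open>\<forall>Q\<in>S. Q w = 0\<close> unfolding S_zero b
      proof
        assume "\<forall>f\<in>I. f (form b \<beta> \<gamma>) = 0"
        then show "\<exists>s d. (\<forall>i. d i \<noteq> 0) \<and> pull (cmat s d) (form a p q) = form b \<beta> \<gamma>"
          unfolding I_def orbit_eqs_form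
          using form_pull_cmat_0I[of a b \<beta> \<gamma> p q] a_nz b_nz by blast
      next
        assume J: "\<forall>g\<in>J. g (form b \<beta> \<gamma>) = 0"
        \<comment> \<open>The shift by 1 with unit entries turns the swapped system \<open>J\<close>
          into the unswapped one for the shifted form, after which a diagonal matrix
          suffices.\<close>
        obtain a' p' q' where a': "pull (cmat 1 (\<lambda>_. 1)) (form a p q) = form a' p' q'"
          "\<And>i. a' (i + 1) = a i * 1\<^sup>2 * 1" and
          cases: "(1 \<in> evens \<and> p' = p * oprod (\<lambda>_. 1) \<and> q' = q * eprod (\<lambda>_. 1) \<and>
             oprod a' = oprod a * (oprod (\<lambda>_. 1))\<^sup>2 * eprod (\<lambda>_. 1) \<and>
             eprod a' = eprod a * (eprod (\<lambda>_. 1))\<^sup>2 * oprod (\<lambda>_. 1)) \<or>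
           (1 \<in> odds \<and> p' = q * eprod (\<lambda>_. 1) \<and> q' = p * oprod (\<lambda>_. 1) \<and>
             oprod a' = eprod a * (eprod (\<lambda>_. 1))\<^sup>2 * oprod (\<lambda>_. 1) \<and>
             eprod a' = oprod a * (oprod (\<lambda>_. 1))\<^sup>2 * eprod (\<lambda>_. 1))"
          by (rule pull_form) (rule that)
        have one: "oprod (\<lambda>_. 1) = 1" "eprod (\<lambda>_. 1) = 1"
          by (simp_all add: oprod_def eprod_def)
        have eqs: "p' = q" "q' = p" "oprod a' = eprod a" "eprod a' = oprod a"
          using cases unfolding one by auto
        have "a' i \<noteq> 0" for i
          using a'(2)[of "i - 1"] a_nz by simp
        then obtain d where d: "\<forall>i. d i \<noteq> 0" "pull (cmat 0 d) (form a' q p) = form b \<beta> \<gamma>"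
          using form_pull_cmat_0I[of a' b \<beta> \<gamma> q p] b_nz J
          unfolding J_def orbit_eqs_form eqs by blast
        have "pull (cmat 0 d) (form a' q p) = pull (cmat 1 (\<lambda>i. d (i + 1))) (form a p q)"
          unfolding a'(1)[unfolded eqs, symmetric] by (simp add: pull_pull cmat_mult)
        then show "\<exists>s d. (\<forall>i. d i \<noteq> 0) \<and> pull (cmat s d) (form a p q) = form b \<beta> \<gamma>"
          using d by (intro exI[of _ 1] exI[of _ "\<lambda>i. d (i + 1)"]) simp
      qed
      then show "y \<in> orbit N_G1 (proj_act change_vars) x"
        unfolding v(3) a orbit_form w(3) by blast
    qed
    moreover have "zariski_closed V_C7 Z"
      unfolding zariski_closed_def Z_def using S_hom by blast
    ultimately show ?thesis by blast
  qed
  have "P (form a p q) \<noteq> 0" using nz P_form by blast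
  moreover from this have "form a p q \<noteq> (\<lambda>_. 0)"
    using P_0 by metis
  ultimately show ?thesis
    unfolding git_stable_def
    using finite_stabilizer_form[OF nz] inv closed
    by (intro conjI exI[of _ 12] exI[of _ P] ballI) auto
qed

theorem proposition3p6:
  fixes a1 a2 a3 a4 a5 a6 a7 a8 :: complex
    and F :: "complex^6 \<Rightarrow> complex"
  assumes "F = (\<lambda>x. a1 * (x$1)^2 * x$2 + a2 * (x$2)^2 * x$3 + a3 * (x$3)^2 * x$4
                  + a4 * (x$4)^2 * x$5 + a5 * (x$5)^2 * x$6 + a6 * (x$6)^2 * x$1
                  + a7 * x$1 * x$3 * x$5 + a8 * x$2 * x$4 * x$6)"
  shows "(git_semistable N_G1 change_vars V_C7 F \<longleftrightarrow>
            (a7 \<noteq> 0 \<and> a8 \<noteq> 0) \<or>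
            (a2 \<noteq> 0 \<and> a4 \<noteq> 0 \<and> a6 \<noteq> 0 \<and> a7 \<noteq> 0) \<or>
            (a1 \<noteq> 0 \<and> a3 \<noteq> 0 \<and> a5 \<noteq> 0 \<and> a8 \<noteq> 0) \<or>
            (a1 \<noteq> 0 \<and> a2 \<noteq> 0 \<and> a3 \<noteq> 0 \<and> a4 \<noteq> 0 \<and> a5 \<noteq> 0 \<and> a6 \<noteq> 0))
       \<and> (git_stable N_G1 change_vars V_C7 F \<longleftrightarrow>
            a1 \<noteq> 0 \<and> a2 \<noteq> 0 \<and> a3 \<noteq> 0 \<and> a4 \<noteq> 0 \<and> a5 \<noteq> 0 \<and> a6 \<noteq> 0)"
proof -
  define a where "a = (\<lambda>i. (vector [a1, a2, a3, a4, a5, a6] :: complex^6) $ i)"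
  have a: "a 1 = a1" "a 2 = a2" "a 3 = a3" "a 4 = a4" "a 5 = a5" "a 6 = a6"
    by (simp_all add: a_def vector_6)
  have F: "F = form a a7 a8"
    unfolding assms form_def sum_6 a by (simp add: numeral_6_reduce)
  have all: "(\<forall>i. a i \<noteq> 0) \<longleftrightarrow> a1 \<noteq> 0 \<and> a2 \<noteq> 0 \<and> a3 \<noteq> 0 \<and> a4 \<noteq> 0 \<and> a5 \<noteq> 0 \<and> a6 \<noteq> 0"
    unfolding forall_6 a by simp
  have "git_semistable N_G1 change_vars V_C7 F \<longleftrightarrow>
      (a7 \<noteq> 0 \<and> a8 \<noteq> 0) \<or> (eprod a \<noteq> 0 \<and> a7 \<noteq> 0) \<or> (oprod a \<noteq> 0 \<and> a8 \<noteq> 0) \<or> (\<forall>i. a i \<noteq> 0)"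
    unfolding F using form_semistable[of a7 a8 a] form_not_semistable[of a7 a8 a] by blast
  moreover have "git_stable N_G1 change_vars V_C7 F \<longleftrightarrow> (\<forall>i. a i \<noteq> 0)"
    unfolding F using form_stable[of a] form_not_stable[of a] by blast
  ultimately show ?thesis
    unfolding all oprod_def eprod_def a by simp
qed

end
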